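(* Let $G$ be a pro-$\mathfrak c$-group, $T$ a profinite space, and let $(G_t)_{t\in T}$ and $(U_t)_{t\in T}$ be families of closed subgroups of $G$ with $U_t\subseteq G_t$ for every $t\in T$, such that $(U_t)_{t\in T}$ is a continuous family. Put $$\mathcal U=\{(g,t)\in G\times T\mid g\in U_t\},\qquad \mathcal G=\{(g,t)\in G\times T\mid g\in G_t\},$$ where $\mathcal U$ carries the topology induced from $G\times T$, and where a set $V\subseteq\mathcal G$ is declared open if and only if $V\cap\mathcal U$ is open in $\mathcal U$ and $V\cap\mathcal G_t$ is an open subset of $G_t$ for all $t\in T$ (identifying the fibre $\mathcal G_t=G_t\times\{t\}$ with $G_t$). Let the projection $pr_{\mathcal G}\colon\mathcal G\to T$ and the maps $m$ (multiplication), $\iota$ (inversion), $e$ (unit) be the restrictions of those of the constant bundle $G\times T$. Then $\mathcal G=(\mathcal G,\mathcal U)$ is a corestricted bundle of pro-$\mathfrak c$-groups over $T$ with respect to $\mathcal U$, and there are continuous inclusions $$\mathcal U\hookrightarrow(\mathcal G,\mathcal U)\overset{\phi}{\hookrightarrow}G\times T.$$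
   Context: $\mathfrak c$ is a class of finite groups closed under subgroups, homomorphic images and finite direct products; a pro-$\mathfrak c$-group is a projective limit of groups in $\mathfrak c$. A profinite space is a projective limit of finite discrete spaces. A bundle of pro-$\mathfrak c$-groups $(\mathcal G,pr,T)$ over a profinite space $T$ is a group object in the category of totally disconnected Hausdorff spaces over $T$ whose fibres are pro-$\mathfrak c$-groups: $\mathcal G$ is a totally disconnected Hausdorff space with continuous maps $pr\colon\mathcal G\to T$, $m\colon\mathcal G\times_T\mathcal G\to\mathcal G$, a section $e\colon T\to\mathcal G$ of $pr$, and $\iota\colon\mathcal G\to\mathcal G$, compatible with the structure maps to $T$, such that every fibre $\mathcal G_t=pr^{-1}(t)$ with the induced operations is a pro-$\mathfrak c$-group. It is compact if $\mathcal G$ is a profinite space. The constant bundle is $G\times T$ with the projection to $T$. A family $(U_t)_{t\in T}$ of closed subgroups of $G$ is continuous if for every open neighbourhood $V$ of the identity of $G$ the set $\{t\in T\mid U_t\subseteq V\}$ is open in $T$; in that case $\mathcal U$ with the topology induced from $G\times T$ is a compact bundle over $T$. A bundle $\mathcal G$ over $T$ is corestricted with respect to a compact bundle $\mathcal U$ over $T$ if there is an injective morphism of bundles $\mathcal U\hookrightarrow\mathcal G$ over $T$ (a continuous map over $T$, homomorphic on fibres) and $\mathcal G$ carries the final topology with respect to the inclusions $\mathcal U\hookrightarrow\mathcal G$ and $\mathcal G_t\hookrightarrow\mathcal G$, $t\in T$. *)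

theory Defs
  imports "HOL-Analysis.Analysis" "HOL-Algebra.Product_Groups"
begin

section \<open>Inverse systems and their limits\<close>

text \<open>The order is given as a relation \<^term>\<open>leq\<close> on the index set, and \<^term>\<open>f i j\<close>
  is the transition map from level \<^term>\<open>j\<close> to level \<^term>\<open>i\<close>, for \<^term>\<open>leq i j\<close>.\<close>

definition directed_set :: "'i set \<Rightarrow> ('i \<Rightarrow> 'i \<Rightarrow> bool) \<Rightarrow> bool" where
  "directed_set I leq \<longleftrightarrow>
     I \<noteq> {} \<and>
     (\<forall>i\<in>I. leq i i) \<and>
     (\<forall>i\<in>I. \<forall>j\<in>I. \<forall>k\<in>I. leq i j \<longrightarrow> leq j k \<longrightarrow> leq i k) \<and>
     (\<forall>i\<in>I. \<forall>j\<in>I. \<exists>k\<in>I. leq i k \<and> leq j k)"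

definition inverse_system ::
    "'i set \<Rightarrow> ('i \<Rightarrow> 'i \<Rightarrow> bool) \<Rightarrow> ('i \<Rightarrow> 'a set) \<Rightarrow> ('i \<Rightarrow> 'i \<Rightarrow> 'a \<Rightarrow> 'a) \<Rightarrow> bool" where
  "inverse_system I leq A f \<longleftrightarrow>
     directed_set I leq \<and>
     (\<forall>i\<in>I. \<forall>j\<in>I. leq i j \<longrightarrow> f i j \<in> A j \<rightarrow> A i) \<and>
     (\<forall>i\<in>I. \<forall>a\<in>A i. f i i a = a) \<and>
     (\<forall>i\<in>I. \<forall>j\<in>I. \<forall>k\<in>I. leq i j \<longrightarrow> leq j k \<longrightarrow> (\<forall>a\<in>A k. f i j (f j k a) = f i k a))"

definition inverse_limit ::
    "'i set \<Rightarrow> ('i \<Rightarrow> 'i \<Rightarrow> bool) \<Rightarrow> ('i \<Rightarrow> 'a set) \<Rightarrow> ('i \<Rightarrow> 'i \<Rightarrow> 'a \<Rightarrow> 'a) \<Rightarrow> ('i \<Rightarrow> 'a) set" where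
  "inverse_limit I leq A f =
     {x \<in> (\<Pi>\<^sub>E i\<in>I. A i). \<forall>i\<in>I. \<forall>j\<in>I. leq i j \<longrightarrow> f i j (x j) = x i}"

definition inverse_limit_topology ::
    "'i set \<Rightarrow> ('i \<Rightarrow> 'i \<Rightarrow> bool) \<Rightarrow> ('i \<Rightarrow> 'a set) \<Rightarrow> ('i \<Rightarrow> 'i \<Rightarrow> 'a \<Rightarrow> 'a) \<Rightarrow> ('i \<Rightarrow> 'a) topology" where
  "inverse_limit_topology I leq A f =
     subtopology (product_topology (\<lambda>i. discrete_topology (A i)) I) (inverse_limit I leq A f)"

text \<open>HOL cannot quantify over the type of indices inside a definition.  Indexing by
  sets of subsets of the space is no restriction: a projective limit of finite discrete
  spaces is the limit of its quotients by finite clopen partitions.  Likewise, every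
  finite set has a copy in \<^typ>\<open>nat\<close>.\<close>

definition profinite_space :: "'a topology \<Rightarrow> bool" where
  "profinite_space X \<longleftrightarrow>
     (\<exists>(I :: 'a set set set) leq (A :: 'a set set \<Rightarrow> nat set) f.
        inverse_system I leq A f \<and> (\<forall>i\<in>I. finite (A i)) \<and>
        X homeomorphic_space inverse_limit_topology I leq A f)"

definition totally_disconnected_space :: "'a topology \<Rightarrow> bool" where
  "totally_disconnected_space X \<longleftrightarrow> (\<forall>S. connectedin X S \<longrightarrow> (\<exists>x. S \<subseteq> {x}))"


section \<open>Pro-C-groups\<close>

text \<open>A class of finite groups is represented by its members with carrier in \<^typ>\<open>nat\<close>.
  Closure under homomorphic images includes closure under isomorphism, so a group
  over another type belongs to the class iff it is isomorphic to one of these members.  The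
  empty product is included.\<close>

definition finite_group_class :: "nat monoid set \<Rightarrow> bool" where
  "finite_group_class C \<longleftrightarrow>
     (\<forall>K\<in>C. group K \<and> finite (carrier K)) \<and>
     (\<forall>K\<in>C. \<forall>S. subgroup S K \<longrightarrow> K\<lparr>carrier := S\<rparr> \<in> C) \<and>
     (\<forall>K\<in>C. \<forall>(L :: nat monoid) h. group L \<and> h \<in> hom K L \<and> h ` carrier K = carrier L \<longrightarrow> L \<in> C) \<and>
     (\<forall>(I :: nat set) F. finite I \<and> (\<forall>i\<in>I. F i \<in> C) \<longrightarrow> (\<exists>K\<in>C. product_group I F \<cong> K))"

definition topological_group :: "'a monoid \<Rightarrow> 'a topology \<Rightarrow> bool" where
  "topological_group G X \<longleftrightarrow>
     group G \<and> topspace X = carrier G \<and>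
     continuous_map (prod_topology X X) X (\<lambda>(x, y). x \<otimes>\<^bsub>G\<^esub> y) \<and>
     continuous_map X X (\<lambda>x. inv\<^bsub>G\<^esub> x)"

text \<open>Indexing by subsets of the group is again no restriction, since a pro-C-group is the
  limit of its quotients by open normal subgroups.\<close>

definition pro_group :: "nat monoid set \<Rightarrow> 'a monoid \<Rightarrow> 'a topology \<Rightarrow> bool" where
  "pro_group C G X \<longleftrightarrow>
     topological_group G X \<and>
     (\<exists>(I :: 'a set set) leq (F :: 'a set \<Rightarrow> nat monoid) f \<phi>.
        (\<forall>i\<in>I. F i \<in> C) \<and>
        inverse_system I leq (\<lambda>i. carrier (F i)) f \<and>
        (\<forall>i\<in>I. \<forall>j\<in>I. leq i j \<longrightarrow> f i j \<in> hom (F j) (F i)) \<and>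
        \<phi> \<in> iso G ((product_group I F)\<lparr>carrier := inverse_limit I leq (\<lambda>i. carrier (F i)) f\<rparr>) \<and>
        homeomorphic_map X (inverse_limit_topology I leq (\<lambda>i. carrier (F i)) f) \<phi>)"

definition closed_subgroup :: "'a monoid \<Rightarrow> 'a topology \<Rightarrow> 'a set \<Rightarrow> bool" where
  "closed_subgroup G X H \<longleftrightarrow> subgroup H G \<and> closedin X H"

definition continuous_family ::
    "'a monoid \<Rightarrow> 'a topology \<Rightarrow> 't topology \<Rightarrow> ('t \<Rightarrow> 'a set) \<Rightarrow> bool" where
  "continuous_family G X T U \<longleftrightarrow>
     (\<forall>t\<in>topspace T. closed_subgroup G X (U t)) \<and>
     (\<forall>V. openin X V \<and> \<one>\<^bsub>G\<^esub> \<in> V \<longrightarrow> openin T {t \<in> topspace T. U t \<subseteq> V})"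


section \<open>Bundles\<close>

record ('x, 't) bundle_data =
  total_space :: "'x topology"
  bproj :: "'x \<Rightarrow> 't"
  bmult :: "'x \<Rightarrow> 'x \<Rightarrow> 'x"
  bunit :: "'t \<Rightarrow> 'x"
  binv :: "'x \<Rightarrow> 'x"

definition fibre :: "('x, 't) bundle_data \<Rightarrow> 't \<Rightarrow> 'x set" where
  "fibre B t = {x \<in> topspace (total_space B). bproj B x = t}"

definition fibre_topology :: "('x, 't) bundle_data \<Rightarrow> 't \<Rightarrow> 'x topology" where
  "fibre_topology B t = subtopology (total_space B) (fibre B t)"

definition fibre_group :: "('x, 't) bundle_data \<Rightarrow> 't \<Rightarrow> 'x monoid" where
  "fibre_group B t = \<lparr>carrier = fibre B t, monoid.mult = bmult B, one = bunit B t\<rparr>"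

definition fibre_product :: "('x, 't) bundle_data \<Rightarrow> ('x \<times> 'x) topology" where
  "fibre_product B =
     subtopology (prod_topology (total_space B) (total_space B)) {(x, y). bproj B x = bproj B y}"

text \<open>The group object axioms over \<^term>\<open>T\<close>: continuity, compatibility with the maps
  to \<^term>\<open>T\<close>, and the commutativity of the associativity, unit and inverse diagrams.\<close>

definition group_object_over :: "'t topology \<Rightarrow> ('x, 't) bundle_data \<Rightarrow> bool" where
  "group_object_over T B \<longleftrightarrow>
     continuous_map (total_space B) T (bproj B) \<and>
     continuous_map (fibre_product B) (total_space B) (\<lambda>(x, y). bmult B x y) \<and>
     continuous_map T (total_space B) (bunit B) \<and>
     continuous_map (total_space B) (total_space B) (binv B) \<and>
     (\<forall>(x, y) \<in> topspace (fibre_product B). bproj B (bmult B x y) = bproj B x) \<and>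
     (\<forall>t \<in> topspace T. bproj B (bunit B t) = t) \<and>
     (\<forall>x \<in> topspace (total_space B). bproj B (binv B x) = bproj B x) \<and>
     (\<forall>t \<in> topspace T. \<forall>x \<in> fibre B t. \<forall>y \<in> fibre B t. \<forall>z \<in> fibre B t.
        bmult B (bmult B x y) z = bmult B x (bmult B y z)) \<and>
     (\<forall>t \<in> topspace T. \<forall>x \<in> fibre B t.
        bmult B (bunit B t) x = x \<and> bmult B x (bunit B t) = x \<and>
        bmult B (binv B x) x = bunit B t \<and> bmult B x (binv B x) = bunit B t)"

definition group_bundle :: "nat monoid set \<Rightarrow> 't topology \<Rightarrow> ('x, 't) bundle_data \<Rightarrow> bool" where
  "group_bundle C T B \<longleftrightarrow>
     profinite_space T \<and>
     totally_disconnected_space (total_space B) \<and> Hausdorff_space (total_space B) \<and>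
     group_object_over T B \<and>
     (\<forall>t \<in> topspace T. pro_group C (fibre_group B t) (fibre_topology B t))"

definition compact_group_bundle :: "nat monoid set \<Rightarrow> 't topology \<Rightarrow> ('x, 't) bundle_data \<Rightarrow> bool" where
  "compact_group_bundle C T B \<longleftrightarrow> group_bundle C T B \<and> profinite_space (total_space B)"

definition bundle_morphism ::
    "'t topology \<Rightarrow> ('x, 't) bundle_data \<Rightarrow> ('y, 't) bundle_data \<Rightarrow> ('x \<Rightarrow> 'y) \<Rightarrow> bool" where
  "bundle_morphism T B B' h \<longleftrightarrow>
     continuous_map (total_space B) (total_space B') h \<and>
     (\<forall>x \<in> topspace (total_space B). bproj B' (h x) = bproj B x) \<and>
     (\<forall>t \<in> topspace T. h \<in> hom (fibre_group B t) (fibre_group B' t))"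

definition injective_bundle_morphism ::
    "'t topology \<Rightarrow> ('x, 't) bundle_data \<Rightarrow> ('y, 't) bundle_data \<Rightarrow> ('x \<Rightarrow> 'y) \<Rightarrow> bool" where
  "injective_bundle_morphism T B B' h \<longleftrightarrow>
     bundle_morphism T B B' h \<and> inj_on h (topspace (total_space B))"

text \<open>The last conjunct says that \<^term>\<open>B\<close> carries the final topology with respect to
  \<^term>\<open>j\<close> and the inclusions of its fibres.\<close>

definition corestricted_bundle_via ::
    "nat monoid set \<Rightarrow> 't topology \<Rightarrow> ('x, 't) bundle_data \<Rightarrow> ('u, 't) bundle_data \<Rightarrow> ('u \<Rightarrow> 'x) \<Rightarrow> bool" where
  "corestricted_bundle_via C T B U j \<longleftrightarrow>
     group_bundle C T B \<and> compact_group_bundle C T U \<and>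
     injective_bundle_morphism T U B j \<and>
     (\<forall>V \<subseteq> topspace (total_space B).
        openin (total_space B) V \<longleftrightarrow>
          openin (total_space U) {u \<in> topspace (total_space U). j u \<in> V} \<and>
          (\<forall>t \<in> topspace T. openin (fibre_topology B t) (V \<inter> fibre B t)))"

definition corestricted_bundle ::
    "nat monoid set \<Rightarrow> 't topology \<Rightarrow> ('x, 't) bundle_data \<Rightarrow> ('u, 't) bundle_data \<Rightarrow> bool" where
  "corestricted_bundle C T B U \<longleftrightarrow> (\<exists>j. corestricted_bundle_via C T B U j)"


section \<open>The bundles attached to families of subgroups\<close>

definition constant_bundle :: "'g monoid \<Rightarrow> 'g topology \<Rightarrow> 't topology \<Rightarrow> ('g \<times> 't, 't) bundle_data" where
  "constant_bundle G X T =
     \<lparr>total_space = prod_topology X T,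
      bproj = snd,
      bmult = (\<lambda>x y. (fst x \<otimes>\<^bsub>G\<^esub> fst y, snd x)),
      bunit = (\<lambda>t. (\<one>\<^bsub>G\<^esub>, t)),
      binv = (\<lambda>x. (inv\<^bsub>G\<^esub> (fst x), snd x))\<rparr>"

definition family_total :: "'t topology \<Rightarrow> ('t \<Rightarrow> 'g set) \<Rightarrow> ('g \<times> 't) set" where
  "family_total T H = {(g, t). t \<in> topspace T \<and> g \<in> H t}"

definition family_topology ::
    "'g topology \<Rightarrow> 't topology \<Rightarrow> ('t \<Rightarrow> 'g set) \<Rightarrow> ('g \<times> 't) topology" where
  "family_topology X T U = subtopology (prod_topology X T) (family_total T U)"

definition corestricted_topology ::
    "'g topology \<Rightarrow> 't topology \<Rightarrow> ('t \<Rightarrow> 'g set) \<Rightarrow> ('t \<Rightarrow> 'g set) \<Rightarrow> ('g \<times> 't) topology" where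
  "corestricted_topology X T H U = topology (\<lambda>V.
     V \<subseteq> family_total T H \<and>
     openin (family_topology X T U) (V \<inter> family_total T U) \<and>
     (\<forall>t \<in> topspace T. openin (subtopology X (H t)) {g. (g, t) \<in> V}))"

lemma openin_corestricted_topology:
  "openin (corestricted_topology X T H U) V \<longleftrightarrow>
     V \<subseteq> family_total T H \<and>
     openin (family_topology X T U) (V \<inter> family_total T U) \<and>
     (\<forall>t \<in> topspace T. openin (subtopology X (H t)) {g. (g, t) \<in> V})"
proof -
  let ?P = "\<lambda>V. V \<subseteq> family_total T H \<and>
     openin (family_topology X T U) (V \<inter> family_total T U) \<and>
     (\<forall>t \<in> topspace T. openin (subtopology X (H t)) {g. (g, t) \<in> V})"
  have "?P (V \<inter> W)" if "?P V" "?P W" for V W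
  proof -
    have "V \<inter> W \<inter> family_total T U = (V \<inter> family_total T U) \<inter> (W \<inter> family_total T U)"
      by blast
    moreover have "{g. (g, t) \<in> V \<inter> W} = {g. (g, t) \<in> V} \<inter> {g. (g, t) \<in> W}" for t
      by blast
    ultimately show ?thesis
      using that by (auto simp only: openin_Int)
  qed
  moreover have "?P (\<Union>\<K>)" if \<K>: "\<And>V. V \<in> \<K> \<Longrightarrow> ?P V" for \<K>
  proof (intro conjI ballI)
    show "\<Union>\<K> \<subseteq> family_total T H"
      using \<K> by blast
    have "openin (family_topology X T U) (\<Union>V\<in>\<K>. V \<inter> family_total T U)"
      using \<K> by (intro openin_Union) blast
    then show "openin (family_topology X T U) (\<Union>\<K> \<inter> family_total T U)"
      by (simp only: Int_Union2)
    show "openin (subtopology X (H t)) {g. (g, t) \<in> \<Union>\<K>}" if "t \<in> topspace T" for t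
    proof -
      have "{g. (g, t) \<in> \<Union>\<K>} = (\<Union>V\<in>\<K>. {g. (g, t) \<in> V})"
        by blast
      moreover have "openin (subtopology X (H t)) (\<Union>V\<in>\<K>. {g. (g, t) \<in> V})"
        using \<K> that by (intro openin_Union) blast
      ultimately show ?thesis
        by (simp only:)
    qed
  qed
  ultimately have "istopology ?P"
    unfolding istopology_def by simp
  then show ?thesis
    unfolding corestricted_topology_def by (simp add: topology_inverse')
qed

definition family_bundle ::
    "'g monoid \<Rightarrow> 'g topology \<Rightarrow> 't topology \<Rightarrow> ('t \<Rightarrow> 'g set) \<Rightarrow> ('g \<times> 't, 't) bundle_data" where
  "family_bundle G X T U = (constant_bundle G X T)\<lparr>total_space := family_topology X T U\<rparr>"

definition corestricted_family_bundle ::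
    "'g monoid \<Rightarrow> 'g topology \<Rightarrow> 't topology \<Rightarrow> ('t \<Rightarrow> 'g set) \<Rightarrow> ('t \<Rightarrow> 'g set)
      \<Rightarrow> ('g \<times> 't, 't) bundle_data" where
  "corestricted_family_bundle G X T H U =
     (constant_bundle G X T)\<lparr>total_space := corestricted_topology X T H U\<rparr>"

end

theory Submission
  imports Defs
begin

text \<open>The only non-formal point is the continuity of multiplication on \<open>\<G> \<times>\<^sub>T \<G>\<close>, since final
  topologies do not commute with fibre products.  If one of the two factors lies outside \<open>\<U>\<close>, it
  has a neighbourhood inside its fibre, and continuity is that of the multiplication of \<open>G\<close>.  If both
  lie in \<open>\<U>\<close>, one takes a neighbourhood in \<open>\<U>\<close>, cut out by cosets of an open normal subgroup, and
  thickens it in each fibre separately by an open normal subgroup chosen by compactness.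

  The Hausdorff property and total disconnectedness are inherited from \<open>G \<times> T\<close>, into which \<open>\<G>\<close> maps
  continuously and injectively.  Continuity of the family \<open>U\<close> makes \<open>\<U>\<close> closed in \<open>G \<times> T\<close>, hence
  profinite, because profinite spaces are the compact spaces whose points are separated by clopen
  sets.\<close>

section \<open>Profinite spaces\<close>

text \<open>An open set of \<open>\<G>\<close> is tested on \<open>\<U>\<close> and on each fibre by
  itself. A neighbourhood of a point of \<open>\<U>\<close> may therefore leave \<open>\<U>\<close>
  by a different amount in every fibre, and it need not contain the trace of any box in
  \<open>G \<times> T\<close>. The obstacle in multiplying two such points is that the product of
  their neighbourhoods has to stay within the allowed amount in all fibres at once. Normal subgroups
  remove it through the identity \<open>(u m)(v m') = (u v)((inv v m v) m')\<close>: the same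
  \<open>M t\<close> serves both factors and the product. Keeping \<open>M t\<close> inside the
  coarser \<open>N\<close> leaves the trace on \<open>\<U>\<close> unchanged, so the thickened sets
  are open although the \<open>M t\<close> are chosen fibre by fibre. Limit presentations are
  handled as families of continuous maps to finite sets or groups that separate points and are
  directed by refinement; on a compact space such a family, with each map onto its level, is a
  presentation. Since the definitions fix the type of the indices, presentations are rebuilt on
  concrete ones: finite sets of clopen sets for spaces, kernels for groups.\<close>

definition clopen_separated :: "'a topology \<Rightarrow> bool" where
  "clopen_separated X \<longleftrightarrow>
     (\<forall>x\<in>topspace X. \<forall>y\<in>topspace X. x \<noteq> y \<longrightarrow>
        (\<exists>K. openin X K \<and> closedin X K \<and> x \<in> K \<and> y \<notin> K))"

text \<open>Clopen sets pull back to clopen sets, and injectivity keeps the points apart. As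
  \<open>f\<close> is not asked to be an embedding, this also covers \<open>\<G>\<close>, whose
  topology is finer than the one induced from \<open>G \<times> T\<close>.\<close>

lemma clopen_separated_continuous_injection:
  assumes Y: "clopen_separated Y" and f: "continuous_map X Y f" and inj: "inj_on f (topspace X)"
  shows "clopen_separated X"
  unfolding clopen_separated_def
proof (intro ballI impI)
  fix x y assume xy: "x \<in> topspace X" "y \<in> topspace X" "x \<noteq> y"
  then have "f x \<in> topspace Y" "f y \<in> topspace Y" "f x \<noteq> f y"
    using continuous_map_image_subset_topspace[OF f] inj by (auto dest: inj_onD)
  then obtain K where "openin Y K" "closedin Y K" "f x \<in> K" "f y \<notin> K"
    using Y unfolding clopen_separated_def by blast
  then show "\<exists>K. openin X K \<and> closedin X K \<and> x \<in> K \<and> y \<notin> K"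
    using f xy by (intro exI[of _ "{x \<in> topspace X. f x \<in> K}"])
      (auto intro: openin_continuous_map_preimage closedin_continuous_map_preimage)
qed

lemma clopen_separated_imp_Hausdorff_space:
  assumes "clopen_separated X" shows "Hausdorff_space X"
  unfolding Hausdorff_space_def
proof (intro allI impI)
  fix x y assume xy: "x \<in> topspace X \<and> y \<in> topspace X \<and> x \<noteq> y"
  then obtain K where "openin X K" "closedin X K" "x \<in> K" "y \<notin> K"
    using assms unfolding clopen_separated_def by blast
  with xy show "\<exists>U V. openin X U \<and> openin X V \<and> x \<in> U \<and> y \<in> V \<and> disjnt U V"
    by (intro exI[of _ K] exI[of _ "topspace X - K"]) (auto simp: disjnt_def)
qed

lemma clopen_separated_imp_totally_disconnected_space:
  assumes "clopen_separated X" shows "totally_disconnected_space X"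
  unfolding totally_disconnected_space_def
proof (intro allI impI)
  fix S assume S: "connectedin X S"
  have "x = y" if "x \<in> S" "y \<in> S" for x y
  proof (rule ccontr)
    assume "x \<noteq> y"
    moreover have "x \<in> topspace X" "y \<in> topspace X"
      using S that connectedin_subset_topspace by blast+
    ultimately obtain K where "openin X K" "closedin X K" "x \<in> K" "y \<notin> K"
      using assms unfolding clopen_separated_def by blast
    then show False
      using connectedin_clopen_cases[OF S] that by (auto simp: disjnt_def)
  qed
  then show "\<exists>x. S \<subseteq> {x}"
    by (metis singletonI subsetI)
qed

lemma clopen_separated_prod_topology:
  assumes X: "clopen_separated X" and Y: "clopen_separated Y"
  shows "clopen_separated (prod_topology X Y)"
  unfolding clopen_separated_def
proof (intro ballI impI)
  fix p q assume pq: "p \<in> topspace (prod_topology X Y)" "q \<in> topspace (prod_topology X Y)" "p \<noteq> q"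
  show "\<exists>K. openin (prod_topology X Y) K \<and> closedin (prod_topology X Y) K \<and> p \<in> K \<and> q \<notin> K"
  proof (cases "fst p = fst q")
    case False
    then obtain K where "openin X K" "closedin X K" "fst p \<in> K" "fst q \<notin> K"
      using X pq unfolding clopen_separated_def topspace_prod_topology mem_Times_iff by blast
    then show ?thesis
      using pq by (intro exI[of _ "K \<times> topspace Y"])
        (auto simp: openin_prod_Times_iff closedin_prod_Times_iff)
  next
    case True
    then have "snd p \<noteq> snd q"
      using pq by (simp add: prod_eq_iff)
    then obtain K where "openin Y K" "closedin Y K" "snd p \<in> K" "snd q \<notin> K"
      using Y pq unfolding clopen_separated_def topspace_prod_topology mem_Times_iff by blast
    then show ?thesis
      using pq by (intro exI[of _ "topspace X \<times> K"])
        (auto simp: openin_prod_Times_iff closedin_prod_Times_iff)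
  qed
qed

section \<open>Limits of directed systems of quotients of a compact space\<close>

lemma compact_space_directed_Inter:
  assumes Y: "compact_space Y" and "I \<noteq> {}"
    and cl: "\<And>i. i \<in> I \<Longrightarrow> closedin Y (C i)" and ne: "\<And>i. i \<in> I \<Longrightarrow> C i \<noteq> {}"
    and dir: "\<And>i j. i \<in> I \<Longrightarrow> j \<in> I \<Longrightarrow> \<exists>k\<in>I. C k \<subseteq> C i \<inter> C j"
  obtains x where "x \<in> topspace Y" "\<And>i. i \<in> I \<Longrightarrow> x \<in> C i"
proof -
  have fin: "\<exists>k\<in>I. C k \<subseteq> \<Inter>\<F>" if "finite \<F>" "\<F> \<subseteq> C ` I" for \<F>
    using that
  proof (induction \<F> rule: finite_induct)
    case empty
    then show ?case using \<open>I \<noteq> {}\<close> by auto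
  next
    case (insert D \<F>)
    then obtain i k where "i \<in> I" "D = C i" "k \<in> I" "C k \<subseteq> \<Inter>\<F>"
      by blast
    with dir[of i k] show ?case
      by auto
  qed
  have "\<Inter>(C ` I) \<noteq> {}"
  proof (rule Y[unfolded compact_space_fip, rule_format], intro conjI ballI allI impI)
    show "closedin Y D" if "D \<in> C ` I" for D
      using that cl by auto
    show "\<Inter>\<F> \<noteq> {}" if \<F>: "finite \<F> \<and> \<F> \<subseteq> C ` I" for \<F>
      using fin[of \<F>] ne \<F> by fastforce
  qed
  then obtain x where "\<And>i. i \<in> I \<Longrightarrow> x \<in> C i"
    by blast
  moreover have "x \<in> topspace Y"
    using calculation \<open>I \<noteq> {}\<close> cl closedin_subset by blast
  ultimately show ?thesis
    using that by blast
qed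

text \<open>Transition maps are read off from the quotient maps: lift \<open>b\<close> along
  \<open>q j\<close>, then apply \<open>q i\<close>. The choice of the lift is harmless as soon as
  \<open>q j x = q j y\<close> forces \<open>q i x = q i y\<close>, so a system can be given by its
  quotient maps alone.\<close>

definition quotient_transition :: "'a set \<Rightarrow> ('i \<Rightarrow> 'a \<Rightarrow> 'b) \<Rightarrow> 'i \<Rightarrow> 'i \<Rightarrow> 'b \<Rightarrow> 'b" where
  "quotient_transition S q i j b = q i (inv_into S (q j) b)"

lemma quotient_transition_apply:
  assumes "x \<in> S" and "\<And>x y. x \<in> S \<Longrightarrow> y \<in> S \<Longrightarrow> q j x = q j y \<Longrightarrow> q i x = q i y"
  shows "quotient_transition S q i j (q j x) = q i x"
  unfolding quotient_transition_def
  using assms(1) by (intro assms(2)) (auto intro: inv_into_into f_inv_into_f)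

lemma inverse_system_quotient_transition:
  assumes dir: "directed_set I leq" and im: "\<And>i. i \<in> I \<Longrightarrow> q i ` S = A i"
    and ker: "\<And>i j x y. i \<in> I \<Longrightarrow> j \<in> I \<Longrightarrow> leq i j \<Longrightarrow> x \<in> S \<Longrightarrow> y \<in> S \<Longrightarrow> q j x = q j y \<Longrightarrow> q i x = q i y"
  shows "inverse_system I leq A (quotient_transition S q)"
proof -
  have app: "quotient_transition S q i j (q j x) = q i x"
    if "i \<in> I" "j \<in> I" "leq i j" "x \<in> S" for i j x
    using that by (intro quotient_transition_apply) (auto intro: ker)
  have ex: "\<exists>x\<in>S. a = q i x" if "i \<in> I" "a \<in> A i" for i a
    using im[OF that(1)] that(2) by blast
  have A: "q i x \<in> A i" if "i \<in> I" "x \<in> S" for i x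
    using im that by blast
  have refl: "leq i i" if "i \<in> I" for i
    using dir that by (simp add: directed_set_def)
  have trans: "leq i k" if "i \<in> I" "j \<in> I" "k \<in> I" "leq i j" "leq j k" for i j k
    using dir that unfolding directed_set_def by blast
  show ?thesis
    unfolding inverse_system_def
  proof (intro conjI ballI impI funcsetI)
    show "directed_set I leq" by fact
    show "quotient_transition S q i j a \<in> A i" if "i \<in> I" "j \<in> I" "leq i j" "a \<in> A j" for i j a
      using ex[OF that(2,4)] that by (auto simp: app A)
    show "quotient_transition S q i i a = a" if "i \<in> I" "a \<in> A i" for i a
      using ex[OF that] that by (auto simp: app refl)
    show "quotient_transition S q i j (quotient_transition S q j k a) = quotient_transition S q i k a"
      if "i \<in> I" "j \<in> I" "k \<in> I" "leq i j" "leq j k" "a \<in> A k" for i j k a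
      using ex[OF that(3,6)] that trans[OF that(1-5)] by (auto simp: app)
  qed
qed

text \<open>A continuous bijection from a compact space to a Hausdorff space is a homeomorphism.
  Injectivity is \<open>sep\<close>. Surjectivity is a second use of compactness: for a thread
  \<open>z\<close>, the sets \<open>D i\<close> of points that agree with \<open>z\<close> at level
  \<open>i\<close> are nonempty, closed and directed, and a common point is mapped to
  \<open>z\<close>.\<close>

lemma homeomorphic_map_inverse_limit:
  fixes q :: "'i \<Rightarrow> 'a \<Rightarrow> 'b"
  assumes Y: "compact_space Y" and dir: "directed_set I leq"
    and cont: "\<And>i. i \<in> I \<Longrightarrow> continuous_map Y (discrete_topology (A i)) (q i)"
    and im: "\<And>i. i \<in> I \<Longrightarrow> q i ` topspace Y = A i"
    and ker: "\<And>i j x y. i \<in> I \<Longrightarrow> j \<in> I \<Longrightarrow> leq i j \<Longrightarrow> x \<in> topspace Y \<Longrightarrow> y \<in> topspace Y \<Longrightarrow>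
       q j x = q j y \<Longrightarrow> q i x = q i y"
    and sep: "\<And>x y. x \<in> topspace Y \<Longrightarrow> y \<in> topspace Y \<Longrightarrow> (\<And>i. i \<in> I \<Longrightarrow> q i x = q i y) \<Longrightarrow> x = y"
  shows "homeomorphic_map Y
    (inverse_limit_topology I leq A (quotient_transition (topspace Y) q)) (\<lambda>x. \<lambda>i\<in>I. q i x)"
proof (rule continuous_imp_homeomorphic_map)
  let ?f = "quotient_transition (topspace Y) q"
  let ?L = "inverse_limit_topology I leq A ?f"
  have app: "?f i j (q j x) = q i x" if "i \<in> I" "j \<in> I" "leq i j" "x \<in> topspace Y" for i j x
    using that by (intro quotient_transition_apply) (auto intro: ker)
  have topL: "topspace ?L = inverse_limit I leq A ?f"
    by (auto simp: inverse_limit_topology_def inverse_limit_def)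
  have inL: "(\<lambda>i\<in>I. q i x) \<in> inverse_limit I leq A ?f" if "x \<in> topspace Y" for x
    using that im by (auto simp: inverse_limit_def app)
  show "continuous_map Y ?L (\<lambda>x. \<lambda>i\<in>I. q i x)"
    unfolding inverse_limit_topology_def
    by (intro continuous_map_into_subtopology)
      (auto simp: continuous_map_componentwise inL intro: cont)
  show "compact_space Y" by fact
  show "Hausdorff_space ?L"
    unfolding inverse_limit_topology_def
    by (intro Hausdorff_space_subtopology) (simp add: Hausdorff_space_product_topology)
  show "inj_on (\<lambda>x. \<lambda>i\<in>I. q i x) (topspace Y)"
    by (intro inj_onI sep) (auto, metis restrict_apply')
  have "z \<in> (\<lambda>x. \<lambda>i\<in>I. q i x) ` topspace Y" if z: "z \<in> inverse_limit I leq A ?f" for z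
  proof -
    define D where "D i = {x \<in> topspace Y. q i x \<in> {z i}}" for i
    have zA: "z i \<in> A i" if "i \<in> I" for i
      using z that by (auto simp: inverse_limit_def)
    have mono: "D k \<subseteq> D i" if "i \<in> I" "k \<in> I" "leq i k" for i k
      using z that app[OF that] unfolding inverse_limit_def D_def by force
    obtain x where "x \<in> topspace Y" "\<And>i. i \<in> I \<Longrightarrow> x \<in> D i"
    proof (rule compact_space_directed_Inter[OF Y])
      show "I \<noteq> {}" using dir by (simp add: directed_set_def)
      show "closedin Y (D i)" if "i \<in> I" for i
        unfolding D_def using cont[OF that] zA[OF that]
        by (intro closedin_continuous_map_preimage) auto
      show "D i \<noteq> {}" if "i \<in> I" for i
        using im[OF that] zA[OF that] unfolding D_def by force
      show "\<exists>k\<in>I. D k \<subseteq> D i \<inter> D j" if "i \<in> I" "j \<in> I" for i j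
        using dir that mono unfolding directed_set_def by (metis Int_greatest)
    qed blast
    then have "z = (\<lambda>i\<in>I. q i x)"
      using z by (intro ext) (auto simp: D_def inverse_limit_def PiE_iff extensional_def)
    with \<open>x \<in> topspace Y\<close> show ?thesis by blast
  qed
  then show "(\<lambda>x. \<lambda>i\<in>I. q i x) ` topspace Y = topspace ?L"
    using inL by (auto simp: topL)
qed

section \<open>Profinite spaces as compact spaces with clopen separation\<close>

lemma topspace_inverse_limit_topology [simp]:
  "topspace (inverse_limit_topology I leq A f) = inverse_limit I leq A f"
  by (auto simp: inverse_limit_topology_def inverse_limit_def)

lemma continuous_map_inverse_limit_component:
  "i \<in> I \<Longrightarrow> continuous_map (inverse_limit_topology I leq A f) (discrete_topology (A i)) (\<lambda>x. x i)"
  unfolding inverse_limit_topology_def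
  by (intro continuous_map_from_subtopology continuous_map_product_projection)

lemma compact_space_inverse_limit_topology:
  assumes sys: "inverse_system I leq A f" and fin: "\<And>i. i \<in> I \<Longrightarrow> finite (A i)"
  shows "compact_space (inverse_limit_topology I leq A f)"
proof -
  let ?P = "product_topology (\<lambda>i. discrete_topology (A i)) I"
  have dir: "directed_set I leq" and f: "\<And>i j. i \<in> I \<Longrightarrow> j \<in> I \<Longrightarrow> leq i j \<Longrightarrow> f i j \<in> A j \<rightarrow> A i"
    using sys unfolding inverse_system_def by blast+
  define E where "E i j = {x \<in> topspace ?P. f i j (x j) = x i}" for i j
  have "closedin ?P (E i j)" if "i \<in> I" "j \<in> I" "leq i j" for i j
    unfolding E_def
  proof (rule closedin_continuous_maps_eq)
    show "continuous_map ?P (discrete_topology (A i)) (\<lambda>x. x i)"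
      using that(1) by (rule continuous_map_product_projection)
    have "continuous_map (discrete_topology (A j)) (discrete_topology (A i)) (f i j)"
      using f[OF that] by simp
    then have "continuous_map ?P (discrete_topology (A i)) (f i j \<circ> (\<lambda>x. x j))"
      using that(2) by (blast intro: continuous_map_compose continuous_map_product_projection)
    then show "continuous_map ?P (discrete_topology (A i)) (\<lambda>x. f i j (x j))"
      by (simp add: o_def)
  qed simp
  \<comment> \<open>The pair \<open>(i, i)\<close> keeps the family of equalizers
    \<open>E i j\<close> nonempty, so that its intersection lies in the product and is closed
    there.\<close>
  moreover obtain i where "i \<in> I" "leq i i"
    using dir unfolding directed_set_def by blast
  moreover have "inverse_limit I leq A f = \<Inter>{E i j |i j. i \<in> I \<and> j \<in> I \<and> leq i j}"
    using \<open>i \<in> I\<close> \<open>leq i i\<close> by (auto simp: inverse_limit_def E_def)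
  ultimately have "closedin ?P (inverse_limit I leq A f)"
    by (auto intro!: closedin_Inter)
  moreover have "compact_space ?P"
    using fin by (simp add: compact_space_product_topology compact_space_discrete_topology)
  ultimately show ?thesis
    unfolding inverse_limit_topology_def
    by (intro compact_space_subtopology closedin_compact_space)
qed

lemma clopen_separated_inverse_limit_topology:
  "clopen_separated (inverse_limit_topology I leq A f)"
  unfolding clopen_separated_def
proof (intro ballI impI)
  let ?L = "inverse_limit_topology I leq A f"
  fix x y assume xy: "x \<in> topspace ?L" "y \<in> topspace ?L" "x \<noteq> y"
  then obtain i where i: "i \<in> I" "x i \<noteq> y i" "x i \<in> A i"
    by (auto simp: inverse_limit_def PiE_iff extensional_def fun_eq_iff) metis
  note cont = continuous_map_inverse_limit_component[OF i(1), of leq A f]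
  have "openin ?L {u \<in> topspace ?L. u i \<in> {x i}}" "closedin ?L {u \<in> topspace ?L. u i \<in> {x i}}"
    by (rule openin_continuous_map_preimage[OF cont] closedin_continuous_map_preimage[OF cont],
        simp add: i)+
  then show "\<exists>K. openin ?L K \<and> closedin ?L K \<and> x \<in> K \<and> y \<notin> K"
    using xy i by (intro exI[of _ "{u \<in> topspace ?L. u i \<in> {x i}}"]) auto
qed

lemma profinite_space_compact_clopen_separated:
  assumes "profinite_space X"
  shows "compact_space X" "clopen_separated X"
proof -
  obtain I leq and A :: "'a set set \<Rightarrow> nat set" and f
    where sys: "inverse_system I leq A f" "\<And>i. i \<in> I \<Longrightarrow> finite (A i)"
      and "X homeomorphic_space inverse_limit_topology I leq A f"
    using assms unfolding profinite_space_def by blast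
  then obtain h where h: "homeomorphic_map X (inverse_limit_topology I leq A f) h"
    using homeomorphic_space by blast
  show "compact_space X"
    using compact_space_inverse_limit_topology[OF sys] homeomorphic_compact_space[OF homeomorphic_map_imp_homeomorphic_space[OF h]]
    by blast
  show "clopen_separated X"
    by (rule clopen_separated_continuous_injection[OF clopen_separated_inverse_limit_topology])
      (use h in \<open>auto intro: homeomorphic_imp_continuous_map homeomorphic_imp_injective_map\<close>)
qed

lemma profinite_spaceI:
  assumes X: "compact_space X" "clopen_separated X"
  shows "profinite_space X"
proof -
  \<comment> \<open>Each finite set \<open>F\<close> of clopen sets gives the finite quotient that records which members of
    \<open>F\<close> contain a point.  Such quotients are directed by inclusion without forming partitions.\<close>
  define I where "I = {F. finite F \<and> (\<forall>K\<in>F. openin X K \<and> closedin X K)}"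
  \<comment> \<open>The levels in \<open>profinite_space\<close> are subsets of \<open>nat\<close>,
    so the subset of \<open>F\<close> attached to a point is coded by an enumeration of the finite
    set \<open>Pow F\<close>.\<close>
  define q where "q F (x :: 'a) = to_nat_on (Pow F) {K \<in> F. x \<in> K}" for F x
  define A where "A F = q F ` topspace X" for F
  let ?f = "quotient_transition (topspace X) q"
  have q_eq: "q F x = q F y \<longleftrightarrow> (\<forall>K\<in>F. x \<in> K \<longleftrightarrow> y \<in> K)" if "F \<in> I" for F x y
    using that countable_finite[of "Pow F"] unfolding q_def I_def
    by (subst inj_on_eq_iff[OF inj_on_to_nat_on, of "Pow F"]) auto
  have dir: "directed_set I (\<subseteq>)"
    unfolding directed_set_def
  proof (intro conjI ballI impI)
    show "I \<noteq> {}" by (auto simp: I_def)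
    show "\<exists>k\<in>I. i \<subseteq> k \<and> j \<subseteq> k" if "i \<in> I" "j \<in> I" for i j
      using that by (intro bexI[of _ "i \<union> j"]) (auto simp: I_def)
  qed auto
  have fin: "finite (A F)" if "F \<in> I" for F
  proof -
    have "A F \<subseteq> to_nat_on (Pow F) ` Pow F"
      by (auto simp: A_def q_def)
    then show ?thesis
      using that by (auto simp: I_def intro: finite_subset)
  qed
  have ker: "q i x = q i y" if "i \<in> I" "j \<in> I" "i \<subseteq> j" "q j x = q j y" for i j x y
    using that by (auto simp: q_eq)
  have cont: "continuous_map X (discrete_topology (A F)) (q F)" if F: "F \<in> I" for F
    unfolding continuous_map_def
  proof (intro conjI allI impI)
    show "q F \<in> topspace X \<rightarrow> topspace (discrete_topology (A F))"
      by (auto simp: A_def)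
    fix V
    show "openin X {x \<in> topspace X. q F x \<in> V}"
    proof (subst openin_subopen, intro ballI)
      fix x assume x: "x \<in> {x \<in> topspace X. q F x \<in> V}"
      \<comment> \<open>The points of \<open>?N\<close> lie on the same side of every member of
        \<open>F\<close> as \<open>x\<close> does, so \<open>q F\<close> is constant there.\<close>
      let ?N = "topspace X \<inter> \<Inter>((\<lambda>K. if x \<in> K then K else topspace X - K) ` F)"
      have "openin X ?N"
        using F by (auto simp: I_def intro!: openin_Int_Inter)
      moreover have "q F y = q F x" if "y \<in> ?N" for y
        using that F by (auto simp: q_eq split: if_splits)
      ultimately show "\<exists>T. openin X T \<and> x \<in> T \<and> T \<subseteq> {x \<in> topspace X. q F x \<in> V}"
        using x by (intro exI[of _ ?N]) auto
    qed
  qed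
  have sep: "x = y" if xy: "x \<in> topspace X" "y \<in> topspace X" and eq: "\<And>F. F \<in> I \<Longrightarrow> q F x = q F y" for x y
  proof (rule ccontr)
    assume "x \<noteq> y"
    then obtain K where "openin X K" "closedin X K" "x \<in> K" "y \<notin> K"
      using X(2) xy unfolding clopen_separated_def by blast
    then show False
      using eq[of "{K}"] q_eq[of "{K}"] by (auto simp: I_def)
  qed
  have "inverse_system I (\<subseteq>) A ?f"
    by (rule inverse_system_quotient_transition[OF dir]) (auto simp: A_def dest: ker)
  moreover have "homeomorphic_map X (inverse_limit_topology I (\<subseteq>) A ?f) (\<lambda>x. \<lambda>F\<in>I. q F x)"
    by (rule homeomorphic_map_inverse_limit[OF X(1) dir cont]) (auto simp: A_def dest: ker intro: sep)
  ultimately show ?thesis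
    using fin homeomorphic_map_imp_homeomorphic_space unfolding profinite_space_def by blast
qed

section \<open>Pro-C-groups\<close>

lemma (in group_hom) eq_iff_kernel:
  assumes "x \<in> carrier G" "y \<in> carrier G"
  shows "h x = h y \<longleftrightarrow> x \<otimes> inv y \<in> kernel G H h"
proof -
  have "h x \<otimes>\<^bsub>H\<^esub> inv\<^bsub>H\<^esub> h y = \<one>\<^bsub>H\<^esub> \<longleftrightarrow> h x = h y"
    using assms by (metis H.inv_closed H.inv_equality H.inv_inv H.r_inv hom_closed)
  then show ?thesis
    using assms by (simp add: kernel_def)
qed

lemma finite_group_classD:
  assumes "finite_group_class C" "K \<in> C"
  shows "group K" "finite (carrier K)" "subgroup S K \<Longrightarrow> K\<lparr>carrier := S\<rparr> \<in> C"
  using assms unfolding finite_group_class_def by blast+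

text \<open>The order and the transition maps of a presentation are replaced by refinement of the
  coordinate maps, a form that pulls back along homomorphisms. The \<open>q i\<close> are not
  claimed to be onto \<open>F i\<close>; images are taken when a new system is built from
  them.\<close>

lemma pro_group_quotients:
  assumes "pro_group C G X"
  obtains I :: "'a set set" and F :: "'a set \<Rightarrow> nat monoid" and q :: "'a set \<Rightarrow> 'a \<Rightarrow> nat"
  where "I \<noteq> {}" "\<And>i. i \<in> I \<Longrightarrow> F i \<in> C" "\<And>i. i \<in> I \<Longrightarrow> q i \<in> hom G (F i)"
    "\<And>i. i \<in> I \<Longrightarrow> continuous_map X (discrete_topology (carrier (F i))) (q i)"
    "\<And>i j. i \<in> I \<Longrightarrow> j \<in> I \<Longrightarrow> \<exists>k\<in>I. \<forall>x\<in>carrier G. \<forall>y\<in>carrier G.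
       q k x = q k y \<longrightarrow> q i x = q i y \<and> q j x = q j y"
    "\<And>x y. x \<in> carrier G \<Longrightarrow> y \<in> carrier G \<Longrightarrow> (\<And>i. i \<in> I \<Longrightarrow> q i x = q i y) \<Longrightarrow> x = y"
proof -
  obtain I :: "'a set set" and leq and F :: "'a set \<Rightarrow> nat monoid" and f \<phi>
    where F: "\<And>i. i \<in> I \<Longrightarrow> F i \<in> C"
      and sys: "inverse_system I leq (\<lambda>i. carrier (F i)) f"
      and iso: "\<phi> \<in> iso G ((product_group I F)\<lparr>carrier := inverse_limit I leq (\<lambda>i. carrier (F i)) f\<rparr>)"
      and homeo: "homeomorphic_map X (inverse_limit_topology I leq (\<lambda>i. carrier (F i)) f) \<phi>"
    using assms unfolding pro_group_def by blast
  have dir: "directed_set I leq"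
    using sys by (simp add: inverse_system_def)
  have lim: "\<phi> x \<in> inverse_limit I leq (\<lambda>i. carrier (F i)) f" if "x \<in> carrier G" for x
    using iso that by (auto simp: iso_def hom_def)
  have mult: "\<phi> (x \<otimes>\<^bsub>G\<^esub> y) = (\<lambda>i\<in>I. \<phi> x i \<otimes>\<^bsub>F i\<^esub> \<phi> y i)" if "x \<in> carrier G" "y \<in> carrier G" for x y
    using iso that by (auto simp: iso_def hom_def)
  have inj: "inj_on \<phi> (carrier G)"
    using iso by (auto simp: iso_def bij_betw_def)
  have compat: "f i j (\<phi> x j) = \<phi> x i" if "x \<in> carrier G" "i \<in> I" "j \<in> I" "leq i j" for x i j
    using lim[OF that(1)] that by (auto simp: inverse_limit_def)
  show ?thesis
  proof (rule that[of I F "\<lambda>i x. \<phi> x i"])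
    show "I \<noteq> {}"
      using dir by (simp add: directed_set_def)
    show "F i \<in> C" if "i \<in> I" for i
      using F that by blast
    show "(\<lambda>x. \<phi> x i) \<in> hom G (F i)" if "i \<in> I" for i
      using that lim by (auto simp: hom_def mult inverse_limit_def)
    show "continuous_map X (discrete_topology (carrier (F i))) (\<lambda>x. \<phi> x i)" if "i \<in> I" for i
      using continuous_map_compose[OF homeomorphic_imp_continuous_map[OF homeo]
          continuous_map_inverse_limit_component[OF that]]
      by (simp add: o_def)
    show "\<exists>k\<in>I. \<forall>x\<in>carrier G. \<forall>y\<in>carrier G. \<phi> x k = \<phi> y k \<longrightarrow> \<phi> x i = \<phi> y i \<and> \<phi> x j = \<phi> y j"
      if ij: "i \<in> I" "j \<in> I" for i j
    proof -
      obtain k where k: "k \<in> I" "leq i k" "leq j k"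
        using dir ij unfolding directed_set_def by blast
      show ?thesis
        using ij k by (intro bexI[OF _ k(1)]) (metis compat)
    qed
    show "x = y" if "x \<in> carrier G" "y \<in> carrier G" "\<And>i. i \<in> I \<Longrightarrow> \<phi> x i = \<phi> y i" for x y
    proof (rule inj_onD[OF inj _ that(1,2)])
      show "\<phi> x = \<phi> y"
        using lim[OF that(1)] lim[OF that(2)] that(3)
        by (intro PiE_ext) (auto simp: inverse_limit_def)
    qed
  qed
qed

lemma pro_group_imp_topological_group: "pro_group C G X \<Longrightarrow> topological_group G X"
  by (simp add: pro_group_def)

lemma pro_group_compact_clopen_separated:
  assumes C: "finite_group_class C" and G: "pro_group C G X"
  shows "compact_space X" "clopen_separated X"
proof -
  obtain I :: "'a set set" and leq and F :: "'a set \<Rightarrow> nat monoid" and f \<phi>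
    where F: "\<And>i. i \<in> I \<Longrightarrow> F i \<in> C"
      and sys: "inverse_system I leq (\<lambda>i. carrier (F i)) f"
      and homeo: "homeomorphic_map X (inverse_limit_topology I leq (\<lambda>i. carrier (F i)) f) \<phi>"
    using G unfolding pro_group_def by blast
  have "finite (carrier (F i))" if "i \<in> I" for i
    using finite_group_classD(2)[OF C F[OF that]] .
  from compact_space_inverse_limit_topology[OF sys this]
  show "compact_space X"
    using homeomorphic_compact_space[OF homeomorphic_map_imp_homeomorphic_space[OF homeo]] by simp
  show "clopen_separated X"
    by (rule clopen_separated_continuous_injection[OF clopen_separated_inverse_limit_topology])
      (use homeo in \<open>auto intro: homeomorphic_imp_continuous_map homeomorphic_imp_injective_map\<close>)
qed

text \<open>The quotients of \<open>G\<close> pull back along \<open>\<psi>\<close>. Their images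
  are subgroups of members of \<open>C\<close>, hence in \<open>C\<close>; they separate points
  because \<open>\<psi>\<close> is injective; and compactness of \<open>Y\<close> makes
  \<open>K\<close> the whole limit, with the limit topology.\<close>

lemma pro_group_continuous_injection:
  fixes G :: "'g monoid" and K :: "'k monoid"
  assumes C: "finite_group_class C" and G: "pro_group C G X"
    and K: "topological_group K Y" and Y: "compact_space Y"
    and \<psi>: "continuous_map Y X \<psi>" "\<psi> \<in> hom K G" "inj_on \<psi> (carrier K)"
  shows "pro_group C K Y"
proof -
  interpret K: group K
    using K by (simp add: topological_group_def)
  interpret G: group G
    using G by (simp add: pro_group_def topological_group_def)
  have top: "topspace Y = carrier K"
    using K by (simp add: topological_group_def)
  obtain I :: "'g set set" and F :: "'g set \<Rightarrow> nat monoid" and q :: "'g set \<Rightarrow> 'g \<Rightarrow> nat"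
    where "I \<noteq> {}" and F: "\<And>i. i \<in> I \<Longrightarrow> F i \<in> C" and q: "\<And>i. i \<in> I \<Longrightarrow> q i \<in> hom G (F i)"
      and cont: "\<And>i. i \<in> I \<Longrightarrow> continuous_map X (discrete_topology (carrier (F i))) (q i)"
      and dir: "\<And>i j. i \<in> I \<Longrightarrow> j \<in> I \<Longrightarrow> \<exists>k\<in>I. \<forall>x\<in>carrier G. \<forall>y\<in>carrier G.
        q k x = q k y \<longrightarrow> q i x = q i y \<and> q j x = q j y"
      and sep: "\<And>x y. x \<in> carrier G \<Longrightarrow> y \<in> carrier G \<Longrightarrow> (\<And>i. i \<in> I \<Longrightarrow> q i x = q i y) \<Longrightarrow> x = y"
    by (rule pro_group_quotients[OF G]) blast
  define r where "r i = q i \<circ> \<psi>" for i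
  have r: "group_hom K (F i) (r i)" if "i \<in> I" for i
    unfolding group_hom_def group_hom_axioms_def r_def
    using finite_group_classD(1)[OF C F[OF that]] q[OF that] \<psi>(2) K.group_axioms
    by (auto intro: hom_compose)
  define ker where "ker i = kernel K (F i) (r i)" for i
  have ker: "r i x = r i y \<longleftrightarrow> x \<otimes>\<^bsub>K\<^esub> inv\<^bsub>K\<^esub> y \<in> ker i"
    if "i \<in> I" "x \<in> carrier K" "y \<in> carrier K" for i x y
    unfolding ker_def using that by (rule group_hom.eq_iff_kernel[OF r])
  \<comment> \<open>Indices for \<open>K\<close> must be subsets of \<open>K\<close>, so the quotients are indexed by their kernels.\<close>
  define J where "J = ker ` I"
  \<comment> \<open>Different indices may share a kernel, and \<open>c\<close> selects one of them.
    Which points \<open>p N\<close> identifies depends on \<open>N\<close> alone, as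
    \<open>p_eq\<close> records, so the transition maps are insensitive to the selection.\<close>
  define c where "c = inv_into I ker"
  have c: "c N \<in> I" "ker (c N) = N" if "N \<in> J" for N
    using that by (auto simp: J_def c_def inv_into_into f_inv_into_f)
  define p where "p N = r (c N)" for N
  have p: "group_hom K (F (c N)) (p N)" if "N \<in> J" for N
    unfolding p_def by (rule r) (rule c(1)[OF that])
  have p_eq: "p N x = p N y \<longleftrightarrow> x \<otimes>\<^bsub>K\<^esub> inv\<^bsub>K\<^esub> y \<in> N" if "N \<in> J" "x \<in> carrier K" "y \<in> carrier K" for N x y
    using ker[OF c(1)[OF that(1)] that(2,3)] c(2)[OF that(1)] by (simp add: p_def)
  \<comment> \<open>The levels are the images, because \<open>homeomorphic_map_inverse_limit\<close>
    asks for quotient maps onto the levels.\<close>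
  define L where "L N = (F (c N))\<lparr>carrier := p N ` carrier K\<rparr>" for N
  have L: "L N \<in> C" if "N \<in> J" for N
    unfolding L_def using group_hom.img_is_subgroup[OF p[OF that]]
    by (intro finite_group_classD(3)[OF C]) (auto intro: F c(1)[OF that])
  have carL: "carrier (L N) = p N ` carrier K" and multL: "mult (L N) = mult (F (c N))" for N
    by (simp_all add: L_def)
  have p_mult: "p N (x \<otimes>\<^bsub>K\<^esub> y) = p N x \<otimes>\<^bsub>L N\<^esub> p N y" if "N \<in> J" "x \<in> carrier K" "y \<in> carrier K" for N x y
    using group_hom.hom_mult[OF p[OF that(1)] that(2,3)] by (simp add: multL)
  \<comment> \<open>Reversed inclusion: the smaller kernel is the finer quotient.\<close>
  let ?leq = "\<lambda>N M. M \<subseteq> N"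
  let ?f = "quotient_transition (carrier K) p"
  have p_ker: "p N x = p N y"
    if "N \<in> J" "M \<in> J" "M \<subseteq> N" "x \<in> carrier K" "y \<in> carrier K" "p M x = p M y" for N M x y
    using that by (auto simp: p_eq)
  have f_app: "?f N M (p M x) = p N x" if "N \<in> J" "M \<in> J" "M \<subseteq> N" "x \<in> carrier K" for N M x
    using that by (intro quotient_transition_apply) (auto intro: p_ker)
  have dirJ: "directed_set J ?leq"
    unfolding directed_set_def
  proof (intro conjI ballI impI)
    show "J \<noteq> {}" using \<open>I \<noteq> {}\<close> by (simp add: J_def)
    show "\<exists>k\<in>J. k \<subseteq> N \<and> k \<subseteq> M" if NM: "N \<in> J" "M \<in> J" for N M
    proof -
      obtain i j where ij: "i \<in> I" "N = ker i" "j \<in> I" "M = ker j"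
        using NM by (auto simp: J_def)
      obtain k where k: "k \<in> I" "\<And>x y. x \<in> carrier G \<Longrightarrow> y \<in> carrier G \<Longrightarrow> q k x = q k y \<Longrightarrow>
          q i x = q i y \<and> q j x = q j y"
        using dir[OF ij(1,3)] by blast
      have "x \<in> ker i \<and> x \<in> ker j" if "x \<in> ker k" for x
      proof -
        have x: "x \<in> carrier K"
          using that by (auto simp: ker_def kernel_def)
        have "r k x = r k \<one>\<^bsub>K\<^esub>"
          using ker[OF k(1) x K.one_closed] that x by simp
        moreover have "\<psi> x \<in> carrier G" "\<psi> \<one>\<^bsub>K\<^esub> \<in> carrier G"
          using \<psi>(2) x by (auto simp: hom_def)
        ultimately have "r i x = r i \<one>\<^bsub>K\<^esub>" "r j x = r j \<one>\<^bsub>K\<^esub>"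
          using k(2)[of "\<psi> x" "\<psi> \<one>\<^bsub>K\<^esub>"] by (simp_all add: r_def)
        then show ?thesis
          using ker[OF ij(1) x K.one_closed] ker[OF ij(3) x K.one_closed] x by simp
      qed
      with ij k(1) show ?thesis
        by (auto simp: J_def)
    qed
  qed auto
  have sys: "inverse_system J ?leq (\<lambda>N. carrier (L N)) ?f"
    by (rule inverse_system_quotient_transition[OF dirJ]) (auto simp: carL intro: p_ker)
  have contp: "continuous_map Y (discrete_topology (carrier (L N))) (p N)" if "N \<in> J" for N
  proof -
    have "continuous_map Y (discrete_topology (carrier (F (c N)))) (p N)"
      unfolding p_def r_def using \<psi>(1) cont[OF c(1)[OF that]] by (rule continuous_map_compose)
    then have "continuous_map Y (subtopology (discrete_topology (carrier (F (c N)))) (p N ` carrier K)) (p N)"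
      by (rule continuous_map_into_subtopology) (auto simp: top)
    moreover have "carrier (F (c N)) \<inter> p N ` carrier K = p N ` carrier K"
      using group_hom.hom_closed[OF p[OF that]] by blast
    ultimately show ?thesis
      by (simp add: carL)
  qed
  have sepp: "x = y" if xy: "x \<in> carrier K" "y \<in> carrier K" and eq: "\<And>N. N \<in> J \<Longrightarrow> p N x = p N y" for x y
  proof -
    have "r i x = r i y" if "i \<in> I" for i
      using ker[OF that xy] eq[of "ker i"] p_eq[of "ker i", OF _ xy] that by (auto simp: J_def)
    moreover have "\<psi> x \<in> carrier G" "\<psi> y \<in> carrier G"
      using \<psi>(2) xy by (auto simp: hom_def)
    ultimately have "\<psi> x = \<psi> y"
      by (intro sep) (auto simp: r_def)
    with \<psi>(3) xy show ?thesis
      by (auto dest: inj_onD)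
  qed
  let ?\<Phi> = "\<lambda>x. \<lambda>N\<in>J. p N x"
  have homeo: "homeomorphic_map Y (inverse_limit_topology J ?leq (\<lambda>N. carrier (L N)) ?f) ?\<Phi>"
    unfolding top[symmetric]
    by (rule homeomorphic_map_inverse_limit[OF Y dirJ contp]) (auto simp: carL top intro: p_ker sepp)
  have "bij_betw ?\<Phi> (carrier K) (inverse_limit J ?leq (\<lambda>N. carrier (L N)) ?f)"
    using homeomorphic_imp_surjective_map[OF homeo] homeomorphic_imp_injective_map[OF homeo]
    by (simp add: bij_betw_def top)
  then have "?\<Phi> \<in> iso K ((product_group J L)\<lparr>carrier := inverse_limit J ?leq (\<lambda>N. carrier (L N)) ?f\<rparr>)"
    using bij_betw_imp_surj_on
    by (fastforce simp: iso_def hom_def p_mult intro: restrict_ext)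
  moreover have "?f N M \<in> hom (L M) (L N)" if "N \<in> J" "M \<in> J" "M \<subseteq> N" for N M
    using that by (auto simp: hom_def carL f_app p_mult[symmetric])
  ultimately show ?thesis
    unfolding pro_group_def using K L sys homeo by blast
qed

text \<open>The kernels \<open>N i\<close> are clopen and directed downwards, and only the unit lies
  in all of them. If none were inside \<open>W\<close>, the closed sets \<open>N i - W\<close> would
  share a point by compactness; it would have to be the unit, which lies in
  \<open>W\<close>.\<close>

lemma pro_group_clopen_normal_basis:
  assumes C: "finite_group_class C" and G: "pro_group C G X"
    and W: "openin X W" "\<one>\<^bsub>G\<^esub> \<in> W"
  obtains N where "N \<lhd> G" "openin X N" "closedin X N" "N \<subseteq> W"
proof -
  have tg: "topological_group G X"
    using G by (rule pro_group_imp_topological_group)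
  interpret G: group G
    using tg by (simp add: topological_group_def)
  have top: "topspace X = carrier G"
    using tg by (simp add: topological_group_def)
  obtain I :: "'a set set" and F :: "'a set \<Rightarrow> nat monoid" and q :: "'a set \<Rightarrow> 'a \<Rightarrow> nat"
    where "I \<noteq> {}" and F: "\<And>i. i \<in> I \<Longrightarrow> F i \<in> C" and q: "\<And>i. i \<in> I \<Longrightarrow> q i \<in> hom G (F i)"
      and cont: "\<And>i. i \<in> I \<Longrightarrow> continuous_map X (discrete_topology (carrier (F i))) (q i)"
      and dir: "\<And>i j. i \<in> I \<Longrightarrow> j \<in> I \<Longrightarrow> \<exists>k\<in>I. \<forall>x\<in>carrier G. \<forall>y\<in>carrier G.
        q k x = q k y \<longrightarrow> q i x = q i y \<and> q j x = q j y"
      and sep: "\<And>x y. x \<in> carrier G \<Longrightarrow> y \<in> carrier G \<Longrightarrow> (\<And>i. i \<in> I \<Longrightarrow> q i x = q i y) \<Longrightarrow> x = y"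
    by (rule pro_group_quotients[OF G]) blast
  have hom: "group_hom G (F i) (q i)" if "i \<in> I" for i
    unfolding group_hom_def group_hom_axioms_def
    using finite_group_classD(1)[OF C F[OF that]] q[OF that] G.group_axioms by auto
  define N where "N i = {x \<in> topspace X. q i x \<in> {\<one>\<^bsub>F i\<^esub>}}" for i
  have ker: "N i = kernel G (F i) (q i)" for i
    by (auto simp: N_def kernel_def top)
  have one: "\<one>\<^bsub>F i\<^esub> \<in> carrier (F i)" if "i \<in> I" for i
    using group_hom.hom_one[OF hom[OF that]] group_hom.hom_closed[OF hom[OF that]] G.one_closed by metis
  have clopen: "openin X (N i)" "closedin X (N i)" if "i \<in> I" for i
    unfolding N_def
    by (rule openin_continuous_map_preimage[OF cont[OF that]]
        closedin_continuous_map_preimage[OF cont[OF that]], simp add: one that)+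
  have "\<exists>i\<in>I. N i \<subseteq> W"
  proof (rule ccontr)
    assume *: "\<not> (\<exists>i\<in>I. N i \<subseteq> W)"
    obtain x where x: "x \<in> topspace X" "\<And>i. i \<in> I \<Longrightarrow> x \<in> N i - W"
    proof (rule compact_space_directed_Inter[OF pro_group_compact_clopen_separated(1)[OF C G] \<open>I \<noteq> {}\<close>])
      show "closedin X (N i - W)" if "i \<in> I" for i
        using clopen[OF that] W(1) by (simp add: closedin_diff)
      show "N i - W \<noteq> {}" if "i \<in> I" for i
        using * that by blast
      show "\<exists>k\<in>I. N k - W \<subseteq> (N i - W) \<inter> (N j - W)" if ij: "i \<in> I" "j \<in> I" for i j
      proof -
        obtain k where k: "k \<in> I" "\<And>x y. x \<in> carrier G \<Longrightarrow> y \<in> carrier G \<Longrightarrow> q k x = q k y \<Longrightarrow>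
            q i x = q i y \<and> q j x = q j y"
          using dir[OF ij] by blast
        have "N k \<subseteq> N i \<inter> N j"
        proof
          fix x assume "x \<in> N k"
          then have "x \<in> carrier G" "q k x = q k \<one>\<^bsub>G\<^esub>"
            using group_hom.hom_one[OF hom[OF k(1)]] by (auto simp: N_def top)
          then show "x \<in> N i \<inter> N j"
            using k(2)[of x "\<one>\<^bsub>G\<^esub>"] group_hom.hom_one[OF hom[OF ij(1)]]
              group_hom.hom_one[OF hom[OF ij(2)]] by (auto simp: N_def top)
        qed
        with k(1) show ?thesis by blast
      qed
    qed blast
    have "x = \<one>\<^bsub>G\<^esub>"
      using x by (intro sep) (auto simp: N_def top group_hom.hom_one[OF hom])
    with x W(2) \<open>I \<noteq> {}\<close> show False
      by blast
  qed
  then obtain i where "i \<in> I" "N i \<subseteq> W" by blast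
  with clopen that show ?thesis
    using group_hom.normal_kernel[OF hom] by (metis ker)
qed

section \<open>Bundles\<close>

text \<open>A topological group refers to the inverse determined by its multiplication, whereas the
  bundle supplies \<open>binv\<close>. Identifying the two is what transfers the continuity of
  \<open>binv\<close> to the fibres.\<close>

lemma fibre_group_group:
  assumes B: "group_object_over T B" and t: "t \<in> topspace T"
  shows "group (fibre_group B t)"
    and "x \<in> fibre B t \<Longrightarrow> inv\<^bsub>fibre_group B t\<^esub> x = binv B x"
proof -
  have mult: "bmult B x y \<in> fibre B t" if "x \<in> fibre B t" "y \<in> fibre B t" for x y
  proof -
    have xy: "(x, y) \<in> topspace (fibre_product B)"
      using that by (simp add: fibre_def fibre_product_def)
    then have "bmult B x y \<in> topspace (total_space B)" "bproj B (bmult B x y) = bproj B x"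
      using B continuous_map_image_subset_topspace[of "fibre_product B" "total_space B" "\<lambda>(x, y). bmult B x y"]
      unfolding group_object_over_def by fastforce+
    then show ?thesis
      using that by (simp add: fibre_def)
  qed
  have unit: "bunit B t \<in> fibre B t"
    using B t continuous_map_image_subset_topspace[of T "total_space B" "bunit B"]
    unfolding group_object_over_def fibre_def by blast
  have inv: "binv B x \<in> fibre B t" if "x \<in> fibre B t" for x
    using B that continuous_map_image_subset_topspace[of "total_space B" "total_space B" "binv B"]
    unfolding group_object_over_def fibre_def by auto
  have assoc: "bmult B (bmult B x y) z = bmult B x (bmult B y z)"
    if "x \<in> fibre B t" "y \<in> fibre B t" "z \<in> fibre B t" for x y z
    using B t that unfolding group_object_over_def by blast
  have one: "bmult B (bunit B t) x = x" "bmult B (binv B x) x = bunit B t" if "x \<in> fibre B t" for x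
    using B t that unfolding group_object_over_def by blast+
  have l_inv: "\<exists>y\<in>fibre B t. bmult B y x = bunit B t" if "x \<in> fibre B t" for x
    using that inv one(2) by blast
  show grp: "group (fibre_group B t)"
    by (rule groupI) (auto simp: fibre_group_def mult unit assoc one l_inv)
  show "inv\<^bsub>fibre_group B t\<^esub> x = binv B x" if "x \<in> fibre B t"
    by (rule group.inv_equality[OF grp]) (auto simp: fibre_group_def one inv that)
qed

lemma fibre_topological_group:
  assumes B: "group_object_over T B" and t: "t \<in> topspace T"
  shows "topological_group (fibre_group B t) (fibre_topology B t)"
proof -
  let ?F = "fibre B t" and ?Y = "fibre_topology B t"
  note grp = fibre_group_group[OF B t]
  have top: "topspace ?Y = ?F"
    by (auto simp: fibre_topology_def fibre_def)
  have car: "carrier (fibre_group B t) = ?F" and mult: "mult (fibre_group B t) = bmult B"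
    by (simp_all add: fibre_group_def)
  have prod: "prod_topology ?Y ?Y = subtopology (prod_topology (total_space B) (total_space B)) (?F \<times> ?F)"
    by (simp add: fibre_topology_def subtopology_Times)
  have "continuous_map (prod_topology ?Y ?Y) (total_space B) (\<lambda>(x, y). bmult B x y)"
    unfolding prod
    by (rule continuous_map_from_subtopology_mono[where T = "{(x, y). bproj B x = bproj B y}"])
      (use B in \<open>auto simp: group_object_over_def fibre_product_def fibre_def\<close>)
  moreover have "bmult B x y \<in> ?F" if "x \<in> ?F" "y \<in> ?F" for x y
    using monoid.m_closed[OF group.is_monoid[OF grp(1)]] that unfolding car mult by blast
  ultimately have "continuous_map (prod_topology ?Y ?Y) ?Y (\<lambda>(x, y). bmult B x y)"
    unfolding fibre_topology_def
    by (intro continuous_map_into_subtopology) (auto simp: fibre_def)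
  moreover have "continuous_map ?Y ?Y (\<lambda>x. inv\<^bsub>fibre_group B t\<^esub> x)"
  proof (rule continuous_map_eq)
    have "continuous_map ?Y (total_space B) (binv B)"
      unfolding fibre_topology_def
      by (intro continuous_map_from_subtopology) (use B in \<open>auto simp: group_object_over_def\<close>)
    moreover have "binv B x \<in> ?F" if "x \<in> ?F" for x
      using group.inv_closed[OF grp(1)] that grp(2) unfolding car by metis
    ultimately show "continuous_map ?Y ?Y (binv B)"
      unfolding fibre_topology_def
      by (intro continuous_map_into_subtopology) (auto simp: fibre_def)
  qed (simp add: top grp(2))
  ultimately show ?thesis
    unfolding topological_group_def car mult top using grp(1) by simp
qed

section \<open>The bundles attached to families of subgroups\<close>

lemma topspace_family_topology:
  assumes "\<And>t. t \<in> topspace T \<Longrightarrow> U t \<subseteq> topspace X"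
  shows "topspace (family_topology X T U) = family_total T U"
  using assms by (auto simp: family_topology_def family_total_def)

text \<open>The fibrewise conditions are redundant when both families agree, so that the bundle
  \<open>\<U>\<close> is the corestriction of \<open>\<U>\<close> to itself.\<close>

lemma corestricted_topology_self: "corestricted_topology X T U U = family_topology X T U"
proof (rule topology_eq[THEN iffD2], intro allI)
  fix V
  show "openin (corestricted_topology X T U U) V \<longleftrightarrow> openin (family_topology X T U) V"
  proof
    assume "openin (corestricted_topology X T U U) V"
    then have "V \<inter> family_total T U = V" "openin (family_topology X T U) (V \<inter> family_total T U)"
      by (auto simp: openin_corestricted_topology)
    then show "openin (family_topology X T U) V" by simp
  next
    assume V: "openin (family_topology X T U) V"
    then have sub: "V \<subseteq> family_total T U"
      using openin_subset unfolding family_topology_def by fastforce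
    moreover have "openin (subtopology X (U t)) {g. (g, t) \<in> V}" if t: "t \<in> topspace T" for t
    proof -
      have "continuous_map (subtopology X (U t)) (family_topology X T U) (\<lambda>g. (g, t))"
        unfolding family_topology_def using t
        by (intro continuous_map_into_subtopology continuous_map_from_subtopology continuous_map_pairedI)
          (auto simp: family_total_def)
      then have "openin (subtopology X (U t)) {g \<in> topspace (subtopology X (U t)). (g, t) \<in> V}"
        using V by (rule openin_continuous_map_preimage)
      moreover have "{g \<in> topspace (subtopology X (U t)). (g, t) \<in> V} = {g. (g, t) \<in> V}"
        using sub openin_subset[OF V] by (auto simp: family_total_def family_topology_def)
      ultimately show ?thesis by simp
    qed
    ultimately show "openin (corestricted_topology X T U U) V"
      using V by (simp add: openin_corestricted_topology Int_absorb2)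
  qed
qed

lemma corestricted_family_bundle_self:
  "corestricted_family_bundle G X T U U = family_bundle G X T U"
  by (simp add: corestricted_family_bundle_def family_bundle_def corestricted_topology_self)

lemma constant_bundle_simps [simp]:
  "total_space (constant_bundle G X T) = prod_topology X T"
  "bproj (constant_bundle G X T) = snd"
  "bmult (constant_bundle G X T) = (\<lambda>x y. (fst x \<otimes>\<^bsub>G\<^esub> fst y, snd x))"
  "bunit (constant_bundle G X T) = (\<lambda>t. (\<one>\<^bsub>G\<^esub>, t))"
  "binv (constant_bundle G X T) = (\<lambda>x. (inv\<^bsub>G\<^esub> (fst x), snd x))"
  by (simp_all add: constant_bundle_def)

lemma corestricted_family_bundle_simps [simp]:
  "total_space (corestricted_family_bundle G X T H U) = corestricted_topology X T H U"
  "bproj (corestricted_family_bundle G X T H U) = snd"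
  "bmult (corestricted_family_bundle G X T H U) = (\<lambda>x y. (fst x \<otimes>\<^bsub>G\<^esub> fst y, snd x))"
  "bunit (corestricted_family_bundle G X T H U) = (\<lambda>t. (\<one>\<^bsub>G\<^esub>, t))"
  "binv (corestricted_family_bundle G X T H U) = (\<lambda>x. (inv\<^bsub>G\<^esub> (fst x), snd x))"
  by (simp_all add: corestricted_family_bundle_def)

text \<open>The locale is interpreted a second time with \<open>U\<close> in place of
  \<open>H\<close>. By \<open>corestricted_family_bundle_self\<close>, facts about
  \<open>\<B>\<close> then become facts about the bundle of \<open>U\<close>, whose group and fibre
  axioms come from the same proofs.\<close>

locale pro_group_families =
  fixes C :: "nat monoid set" and G :: "'g monoid" (structure) and X :: "'g topology"
    and T :: "'t topology" and H U :: "'t \<Rightarrow> 'g set"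
  assumes C: "finite_group_class C" and G: "pro_group C G X" and T: "profinite_space T"
    and H: "\<And>t. t \<in> topspace T \<Longrightarrow> closed_subgroup G X (H t)"
    and U: "\<And>t. t \<in> topspace T \<Longrightarrow> closed_subgroup G X (U t)"
    and U_sub_H: "\<And>t. t \<in> topspace T \<Longrightarrow> U t \<subseteq> H t"
begin

abbreviation "\<G> \<equiv> corestricted_topology X T H U"
abbreviation "\<B> \<equiv> corestricted_family_bundle G X T H U"

sublocale group G
  using pro_group_imp_topological_group[OF G] by (simp add: topological_group_def)

lemma topspace_X: "topspace X = carrier G"
  using pro_group_imp_topological_group[OF G] by (simp add: topological_group_def)

lemma continuous_map_mult: "continuous_map (prod_topology X X) X (\<lambda>(x, y). x \<otimes> y)"
  and continuous_map_inv: "continuous_map X X (\<lambda>x. inv x)"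
  using pro_group_imp_topological_group[OF G] by (simp_all add: topological_group_def)

lemma subgroup_H: "t \<in> topspace T \<Longrightarrow> subgroup (H t) G"
  and subgroup_U: "t \<in> topspace T \<Longrightarrow> subgroup (U t) G"
  and closedin_H: "t \<in> topspace T \<Longrightarrow> closedin X (H t)"
  and closedin_U: "t \<in> topspace T \<Longrightarrow> closedin X (U t)"
  using H U by (simp_all add: closed_subgroup_def)

lemma H_carrier: "t \<in> topspace T \<Longrightarrow> x \<in> H t \<Longrightarrow> x \<in> carrier G"
  by (rule subgroup.mem_carrier[OF subgroup_H])

lemma U_carrier: "t \<in> topspace T \<Longrightarrow> x \<in> U t \<Longrightarrow> x \<in> carrier G"
  by (rule subgroup.mem_carrier[OF subgroup_U])

lemma continuous_map_left_translation:
  assumes "a \<in> carrier G" shows "continuous_map X X (\<lambda>x. a \<otimes> x)"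
proof -
  have "continuous_map X (prod_topology X X) (\<lambda>x. (a, x))"
    using assms by (intro continuous_map_pairedI) (auto simp: topspace_X)
  from continuous_map_compose[OF this continuous_map_mult] show ?thesis
    by (simp add: o_def)
qed

lemma topspace_U: "topspace (family_topology X T U) = family_total T U"
  using U_carrier by (intro topspace_family_topology) (auto simp: topspace_X)

lemma topspace_corestricted: "topspace \<G> = family_total T H"
proof
  have "family_total T H \<inter> family_total T U = topspace (family_topology X T U)"
    using U_sub_H by (auto simp: topspace_U family_total_def)
  moreover have "{g. (g, t) \<in> family_total T H} = topspace (subtopology X (H t))" if "t \<in> topspace T" for t
    using that H_carrier by (auto simp: family_total_def topspace_X)
  ultimately have "openin \<G> (family_total T H)"
    unfolding openin_corestricted_topology by (auto simp: openin_topspace simp del: topspace_subtopology)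
  then show "family_total T H \<subseteq> topspace \<G>"
    by (rule openin_subset)
  show "topspace \<G> \<subseteq> family_total T H"
    using openin_topspace[of \<G>] unfolding openin_corestricted_topology by blast
qed

text \<open>Openness in \<open>\<G>\<close> is tested along the inclusions of \<open>\<U>\<close>
  and of the fibres, and all of these are continuous into \<open>G \<times> T\<close>.\<close>

lemma continuous_map_into_constant: "continuous_map \<G> (prod_topology X T) (\<lambda>x. x)"
  unfolding continuous_map_def
proof (intro conjI allI impI)
  show "(\<lambda>x. x) \<in> topspace \<G> \<rightarrow> topspace (prod_topology X T)"
    using H_carrier by (auto simp: topspace_corestricted family_total_def topspace_X)
  fix V assume V: "openin (prod_topology X T) V"
  have "family_total T H \<inter> V \<inter> family_total T U = V \<inter> family_total T U"
    using U_sub_H by (auto simp: family_total_def)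
  then have "openin (family_topology X T U) (family_total T H \<inter> V \<inter> family_total T U)"
    using V unfolding family_topology_def openin_subtopology by auto
  moreover have "openin (subtopology X (H t)) {g. (g, t) \<in> family_total T H \<inter> V}" if t: "t \<in> topspace T" for t
  proof -
    have "continuous_map X (prod_topology X T) (\<lambda>g. (g, t))"
      using t by (intro continuous_map_pairedI) auto
    then have "openin X {g \<in> topspace X. (g, t) \<in> V}"
      using V by (rule openin_continuous_map_preimage)
    moreover have "{g. (g, t) \<in> family_total T H \<inter> V} = {g \<in> topspace X. (g, t) \<in> V} \<inter> H t"
      using t H_carrier by (auto simp: family_total_def topspace_X)
    ultimately show ?thesis
      unfolding openin_subtopology by blast
  qed
  ultimately have "openin \<G> (family_total T H \<inter> V)"
    by (auto simp: openin_corestricted_topology)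
  then show "openin \<G> {x \<in> topspace \<G>. x \<in> V}"
    by (simp add: topspace_corestricted Int_def)
qed

lemma continuous_map_fibre_inclusion:
  assumes "t \<in> topspace T"
  shows "continuous_map (subtopology X (H t)) \<G> (\<lambda>g. (g, t))"
  unfolding continuous_map_def
proof (intro conjI allI impI)
  show "(\<lambda>g. (g, t)) \<in> topspace (subtopology X (H t)) \<rightarrow> topspace \<G>"
    using assms by (auto simp: topspace_corestricted family_total_def)
  fix V assume V: "openin \<G> V"
  then have "{g \<in> topspace (subtopology X (H t)). (g, t) \<in> V} = {g. (g, t) \<in> V}"
    using assms H_carrier by (auto simp: openin_corestricted_topology family_total_def topspace_X)
  then show "openin (subtopology X (H t)) {g \<in> topspace (subtopology X (H t)). (g, t) \<in> V}"
    using V assms by (simp add: openin_corestricted_topology)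
qed

lemma continuous_map_from_U: "continuous_map (family_topology X T U) \<G> (\<lambda>x. x)"
  unfolding continuous_map_def
proof (intro conjI allI impI)
  show "(\<lambda>x. x) \<in> topspace (family_topology X T U) \<rightarrow> topspace \<G>"
    using U_sub_H by (auto simp: topspace_corestricted topspace_U family_total_def)
  fix V assume "openin \<G> V"
  then show "openin (family_topology X T U) {x \<in> topspace (family_topology X T U). x \<in> V}"
    by (simp add: openin_corestricted_topology topspace_U Int_def conj_commute)
qed

text \<open>Away from \<open>\<U>\<close> the corestricted topology is the disjoint union of the fibres.\<close>

lemma openin_fibre_outside_U:
  assumes t: "t \<in> topspace T" and W: "openin X W"
  shows "openin \<G> ((W \<inter> H t - U t) \<times> {t})"
  unfolding openin_corestricted_topology
proof (intro conjI ballI)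
  show "(W \<inter> H t - U t) \<times> {t} \<subseteq> family_total T H"
    using t by (auto simp: family_total_def)
  have "(W \<inter> H t - U t) \<times> {t} \<inter> family_total T U = {}"
    by (auto simp: family_total_def)
  then show "openin (family_topology X T U) ((W \<inter> H t - U t) \<times> {t} \<inter> family_total T U)"
    by simp
  fix s assume "s \<in> topspace T"
  show "openin (subtopology X (H s)) {g. (g, s) \<in> (W \<inter> H t - U t) \<times> {t}}"
  proof (cases "s = t")
    case True
    then have "{g. (g, s) \<in> (W \<inter> H t - U t) \<times> {t}} = (W - U t) \<inter> H s"
      by auto
    moreover have "openin X (W - U t)"
      using W closedin_U[OF t] by (rule openin_diff)
    ultimately show ?thesis
      unfolding openin_subtopology by blast
  qed simp
qed

section \<open>Continuity of the group operations\<close>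

lemma openin_corestricted_restriction:
  assumes "openin (prod_topology X T) W" shows "openin \<G> (family_total T H \<inter> W)"
  using openin_continuous_map_preimage[OF continuous_map_into_constant assms]
  by (simp add: topspace_corestricted Int_def)

text \<open>Over \<open>t\<close> the set is the product of \<open>U t \<inter> g N\<close> with
  \<open>M t\<close>, cut down to \<open>H t\<close>, so each slice is open as a union of left
  cosets \<open>u M t\<close>. On \<open>\<U>\<close> the thickening disappears:
  \<open>M t \<subseteq> N\<close> gives \<open>inv g x = (inv g u)(inv u x) \<in> N\<close>, and
  conversely \<open>u = x\<close> is a witness. The trace on \<open>\<U>\<close> is thus that of
  \<open>g N \<times> S\<close>, however \<open>M t\<close> varies with \<open>t\<close>.\<close>

lemma openin_thickening:
  assumes N: "subgroup N G" "openin X N" and S: "openin T S" and g: "g \<in> carrier G"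
    and M: "\<And>t. t \<in> S \<Longrightarrow> subgroup (M t) G \<and> openin X (M t) \<and> M t \<subseteq> N"
  shows "openin \<G> {(x, t). t \<in> S \<and> x \<in> H t \<and> (\<exists>u\<in>U t. inv g \<otimes> u \<in> N \<and> inv u \<otimes> x \<in> M t)}"
    (is "openin \<G> ?V")
  unfolding openin_corestricted_topology
proof (intro conjI ballI)
  have ST: "t \<in> topspace T" if "t \<in> S" for t
    using S that openin_subset by blast
  show "?V \<subseteq> family_total T H"
    using ST by (auto simp: family_total_def)
  let ?W = "{x \<in> topspace X. inv g \<otimes> x \<in> N}"
  have W: "openin X ?W"
    by (rule openin_continuous_map_preimage[OF continuous_map_left_translation]) (use g N in auto)
  have "?V \<inter> family_total T U = ?W \<times> S \<inter> family_total T U"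
  proof safe
    fix x t u assume xt: "(x, t) \<in> family_total T U" "t \<in> S" "u \<in> U t" "inv g \<otimes> u \<in> N" "inv u \<otimes> x \<in> M t"
    then have x: "x \<in> carrier G" "u \<in> carrier G"
      using U_carrier ST by (auto simp: family_total_def)
    then show "x \<in> topspace X" by (simp add: topspace_X)
    have "(inv g \<otimes> u) \<otimes> (inv u \<otimes> x) \<in> N"
      using subgroup.m_closed[OF N(1) xt(4)] xt(5) M[OF xt(2)] by blast
    moreover have "(inv g \<otimes> u) \<otimes> (inv u \<otimes> x) = inv g \<otimes> x"
      using x g by (metis inv_closed inv_solve_left m_assoc m_closed)
    ultimately show "inv g \<otimes> x \<in> N" by simp
  next
    fix x t assume xt: "(x, t) \<in> family_total T U" "t \<in> S" "x \<in> topspace X" "inv g \<otimes> x \<in> N"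
    then have "x \<in> U t" "x \<in> H t" "inv x \<otimes> x \<in> M t"
      using U_sub_H M[of t] by (auto simp: family_total_def topspace_X subgroup.one_closed)
    with xt show "x \<in> H t" "\<exists>u\<in>U t. inv g \<otimes> u \<in> N \<and> inv u \<otimes> x \<in> M t"
      by auto
  qed
  moreover have "openin (prod_topology X T) (?W \<times> S)"
    using W S by (simp add: openin_prod_Times_iff)
  ultimately show "openin (family_topology X T U) (?V \<inter> family_total T U)"
    unfolding family_topology_def openin_subtopology by blast
  fix t assume t: "t \<in> topspace T"
  show "openin (subtopology X (H t)) {x. (x, t) \<in> ?V}"
  proof (cases "t \<in> S")
    case True
    let ?A = "\<Union>u\<in>{u \<in> U t. inv g \<otimes> u \<in> N}. {x \<in> topspace X. inv u \<otimes> x \<in> M t}"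
    have "openin X {x \<in> topspace X. inv u \<otimes> x \<in> M t}" if "u \<in> U t" for u
      by (rule openin_continuous_map_preimage[OF continuous_map_left_translation])
        (use M[OF True] U_carrier[OF t that] in auto)
    then have "openin X ?A"
      by (intro openin_Union) auto
    moreover have "{x. (x, t) \<in> ?V} = ?A \<inter> H t"
      using True H_carrier[OF t] by (auto simp: topspace_X)
    ultimately show ?thesis
      unfolding openin_subtopology by blast
  qed simp
qed

text \<open>On each fibre near \<open>t\<^sub>0\<close> the open set \<open>W\<close> contains the compact part \<open>K t\<close> of \<open>U t\<close> near
  \<open>g \<otimes> h\<close>, hence by Wallace's theorem a thickening of it by some open normal subgroup \<open>M t\<close>.  The
  neighbourhoods are the parts of \<open>U\<close> near \<open>g\<close> and \<open>h\<close>, thickened by the same \<open>M t\<close>; no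
  relation between the \<open>M t\<close> for different \<open>t\<close> is needed.\<close>

lemma mult_neighbourhoods_in_U:
  assumes W: "openin \<G> W" and t0: "t\<^sub>0 \<in> topspace T" and g: "g \<in> U t\<^sub>0" and h: "h \<in> U t\<^sub>0"
    and gh: "(g \<otimes> h, t\<^sub>0) \<in> W"
  obtains V V' where "openin \<G> V" "openin \<G> V'" "(g, t\<^sub>0) \<in> V" "(h, t\<^sub>0) \<in> V'"
    "\<And>x y t. (x, t) \<in> V \<Longrightarrow> (y, t) \<in> V' \<Longrightarrow> (x \<otimes> y, t) \<in> W"
proof -
  have gc: "g \<in> carrier G" and hc: "h \<in> carrier G" and ghU: "g \<otimes> h \<in> U t\<^sub>0"
    using g h U_carrier[OF t0] subgroup.m_closed[OF subgroup_U[OF t0]] by auto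
  have "openin (family_topology X T U) (W \<inter> family_total T U)"
    using W by (simp add: openin_corestricted_topology)
  then obtain Q where Q: "openin (prod_topology X T) Q" "W \<inter> family_total T U = Q \<inter> family_total T U"
    unfolding family_topology_def openin_subtopology by blast
  have "(g \<otimes> h, t\<^sub>0) \<in> Q"
    using Q(2) gh ghU t0 by (auto simp: family_total_def)
  then obtain P S where P: "openin X P" "g \<otimes> h \<in> P" and S: "openin T S" "t\<^sub>0 \<in> S" and PS: "P \<times> S \<subseteq> Q"
    using Q(1) unfolding openin_prod_topology_alt by metis
  have ST: "t \<in> topspace T" if "t \<in> S" for t
    using S that openin_subset by blast
  \<comment> \<open>Translating \<open>P\<close> to the unit yields \<open>N\<close> with
    \<open>g h N \<subseteq> P\<close>.\<close>
  have "openin X {x \<in> topspace X. g \<otimes> h \<otimes> x \<in> P}"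
    by (rule openin_continuous_map_preimage[OF continuous_map_left_translation]) (use P gc hc in auto)
  moreover have "\<one> \<in> {x \<in> topspace X. g \<otimes> h \<otimes> x \<in> P}"
    using P gc hc by (simp add: topspace_X)
  ultimately obtain N where N: "N \<lhd> G" "openin X N" "closedin X N" "N \<subseteq> {x \<in> topspace X. g \<otimes> h \<otimes> x \<in> P}"
    by (rule pro_group_clopen_normal_basis[OF C G])
  have Nsub: "subgroup N G"
    using N(1) normal_imp_subgroup by blast
  \<comment> \<open>This is the part of \<open>U t\<close> in the coset \<open>g h N\<close>. Over
    \<open>S\<close> it lies in \<open>W\<close>, because \<open>W\<close> and \<open>Q\<close> have
    the same trace on \<open>\<U>\<close> and \<open>P \<times> S \<subseteq> Q\<close>.\<close>
  define K where "K t = {k \<in> U t. inv (g \<otimes> h) \<otimes> k \<in> N}" for t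
  have KW: "(k, t) \<in> W" if "t \<in> S" "k \<in> K t" for t k
  proof -
    have kc: "k \<in> carrier G"
      using that U_carrier[OF ST] by (auto simp: K_def)
    have "g \<otimes> h \<otimes> (inv (g \<otimes> h) \<otimes> k) \<in> P"
      using that N(4) by (auto simp: K_def)
    then have "k \<in> P"
      using kc gc hc by (metis inv_closed m_assoc m_closed r_inv l_one)
    then have "(k, t) \<in> Q \<inter> family_total T U"
      using that PS ST by (auto simp: family_total_def K_def)
    with Q(2) show ?thesis by blast
  qed
  have "\<exists>M. M \<lhd> G \<and> openin X M \<and> M \<subseteq> N \<and> (\<forall>k\<in>K t. \<forall>m\<in>M. k \<otimes> m \<in> H t \<longrightarrow> (k \<otimes> m, t) \<in> W)" if t: "t \<in> S" for t
  proof -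
    have "openin (subtopology X (H t)) {x. (x, t) \<in> W}"
      using W ST[OF t] by (simp add: openin_corestricted_topology)
    then obtain R where R: "openin X R" "{x. (x, t) \<in> W} = R \<inter> H t"
      unfolding openin_subtopology by blast
    have "closedin X {k \<in> topspace X. inv (g \<otimes> h) \<otimes> k \<in> N}"
      by (rule closedin_continuous_map_preimage[OF continuous_map_left_translation]) (use gc hc N in auto)
    then have "closedin X (U t \<inter> {k \<in> topspace X. inv (g \<otimes> h) \<otimes> k \<in> N})"
      using closedin_U[OF ST[OF t]] by blast
    moreover have "K t = U t \<inter> {k \<in> topspace X. inv (g \<otimes> h) \<otimes> k \<in> N}"
      using U_carrier[OF ST[OF t]] by (auto simp: K_def topspace_X)
    ultimately have Kc: "compactin X (K t)"
      using closedin_compact_space[OF pro_group_compact_clopen_separated(1)[OF C G]] by simp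
    \<comment> \<open>Multiplication maps the compact set \<open>K t \<times> {\<one>}\<close> into
      \<open>R\<close>. A box around it provides one neighbourhood \<open>B\<close> of the unit with
      \<open>k b \<in> R\<close> for all \<open>k \<in> K t\<close> and \<open>b \<in> B\<close>
      simultaneously.\<close>
    have "compactin X {\<one>}"
      by (simp add: topspace_X)
    moreover have "openin (prod_topology X X) {p \<in> topspace (prod_topology X X). (case p of (x, y) \<Rightarrow> x \<otimes> y) \<in> R}"
      using continuous_map_mult R(1) by (rule openin_continuous_map_preimage)
    moreover have "K t \<times> {\<one>} \<subseteq> {p \<in> topspace (prod_topology X X). (case p of (x, y) \<Rightarrow> x \<otimes> y) \<in> R}"
      using KW[OF t] R(2) U_carrier[OF ST[OF t]] by (auto simp: topspace_X K_def)
    ultimately obtain A B where AB: "openin X A" "openin X B" "K t \<subseteq> A" "{\<one>} \<subseteq> B"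
        "A \<times> B \<subseteq> {p \<in> topspace (prod_topology X X). (case p of (x, y) \<Rightarrow> x \<otimes> y) \<in> R}"
      by (rule Wallace_theorem_prod_topology[OF Kc])
    \<comment> \<open>Intersecting with \<open>N\<close> secures \<open>M \<subseteq> N\<close>, on
      which \<open>openin_thickening\<close> depends.\<close>
    have "openin X (B \<inter> N)" "\<one> \<in> B \<inter> N"
      using AB N(2) subgroup.one_closed[OF Nsub] by auto
    then obtain M where M: "M \<lhd> G" "openin X M" "closedin X M" "M \<subseteq> B \<inter> N"
      by (rule pro_group_clopen_normal_basis[OF C G])
    have "(k \<otimes> m, t) \<in> W" if "k \<in> K t" "m \<in> M" "k \<otimes> m \<in> H t" for k m
    proof -
      have "(k, m) \<in> A \<times> B"
        using that M(4) AB(3) by auto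
      then have "k \<otimes> m \<in> R"
        using AB(5) by auto
      then show ?thesis
        using R(2) that(3) by blast
    qed
    with M show ?thesis by blast
  qed
  then obtain M where M: "\<And>t. t \<in> S \<Longrightarrow> M t \<lhd> G" "\<And>t. t \<in> S \<Longrightarrow> openin X (M t)" "\<And>t. t \<in> S \<Longrightarrow> M t \<subseteq> N"
      "\<And>t k m. t \<in> S \<Longrightarrow> k \<in> K t \<Longrightarrow> m \<in> M t \<Longrightarrow> k \<otimes> m \<in> H t \<Longrightarrow> (k \<otimes> m, t) \<in> W"
    by metis
  have Msub: "subgroup (M t) G" if "t \<in> S" for t
    using M(1)[OF that] normal_imp_subgroup by blast
  define V where "V g = {(x, t). t \<in> S \<and> x \<in> H t \<and> (\<exists>u\<in>U t. inv g \<otimes> u \<in> N \<and> inv u \<otimes> x \<in> M t)}" for g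
  have V_open: "openin \<G> (V a)" if "a \<in> carrier G" for a
    unfolding V_def using M Msub by (intro openin_thickening Nsub N(2) S(1) that) auto
  have V_mem: "(a, t\<^sub>0) \<in> V a" if "a \<in> U t\<^sub>0" for a
    using that S(2) t0 U_sub_H U_carrier[OF t0 that] subgroup.one_closed[OF Nsub] subgroup.one_closed[OF Msub[OF S(2)]]
    by (auto simp: V_def intro!: bexI[of _ a])
  have "(x \<otimes> y, t) \<in> W" if xy: "(x, t) \<in> V g" "(y, t) \<in> V h" for x y t
  proof -
    have t: "t \<in> S" and tT: "t \<in> topspace T" and xH: "x \<in> H t" and yH: "y \<in> H t"
      using xy ST by (auto simp: V_def)
    obtain u where u: "u \<in> U t" "inv g \<otimes> u \<in> N" "inv u \<otimes> x \<in> M t"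
      using xy(1) by (auto simp: V_def)
    obtain v where v: "v \<in> U t" "inv h \<otimes> v \<in> N" "inv v \<otimes> y \<in> M t"
      using xy(2) by (auto simp: V_def)
    have car: "x \<in> carrier G" "y \<in> carrier G" "u \<in> carrier G" "v \<in> carrier G"
      using xH yH u v H_carrier[OF tT] U_carrier[OF tT] by auto
    \<comment> \<open>Write \<open>u = g n\<close> and \<open>v = h n'\<close>. Then
      \<open>u v = g h (inv h n h) n'\<close>, and normality of \<open>N\<close> puts this into
      \<open>g h N\<close>.\<close>
    have "(inv h \<otimes> (inv g \<otimes> u) \<otimes> h) \<otimes> (inv h \<otimes> v) \<in> N"
      using u(2) v(2) normal.inv_op_closed1[OF N(1) hc] subgroup.m_closed[OF Nsub] by blast
    moreover have "(inv h \<otimes> (inv g \<otimes> u) \<otimes> h) \<otimes> (inv h \<otimes> v) = inv (g \<otimes> h) \<otimes> (u \<otimes> v)"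
      using car gc hc by (simp add: m_assoc inv_mult_group inv_solve_left' flip: m_assoc[of h "inv h"])
    ultimately have "u \<otimes> v \<in> K t"
      using u(1) v(1) subgroup.m_closed[OF subgroup_U[OF tT]] by (simp add: K_def)
    \<comment> \<open>The same rearrangement with \<open>M t\<close>: for \<open>x = u m\<close> and
      \<open>y = v m'\<close> the product is \<open>u v (inv v m v) m'\<close>, an element of
      \<open>K t\<close> times one of \<open>M t\<close>.\<close>
    moreover have "(inv v \<otimes> (inv u \<otimes> x) \<otimes> v) \<otimes> (inv v \<otimes> y) \<in> M t"
      using u(3) v(3) normal.inv_op_closed1[OF M(1)[OF t] car(4)] subgroup.m_closed[OF Msub[OF t]] by blast
    moreover have "(u \<otimes> v) \<otimes> ((inv v \<otimes> (inv u \<otimes> x) \<otimes> v) \<otimes> (inv v \<otimes> y)) = x \<otimes> y"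
      using car by (simp add: m_assoc flip: m_assoc[of v "inv v"] m_assoc[of u "inv u"])
    ultimately show ?thesis
      using M(4)[OF t] subgroup.m_closed[OF subgroup_H[OF tT] xH yH] by metis
  qed
  then show ?thesis
    using that[of "V g" "V h"] V_open V_mem gc hc g h by blast
qed

lemma mult_neighbourhoods:
  assumes W: "openin \<G> W" and t0: "t\<^sub>0 \<in> topspace T" and g: "g \<in> H t\<^sub>0" and h: "h \<in> H t\<^sub>0"
    and gh: "(g \<otimes> h, t\<^sub>0) \<in> W"
  obtains V V' where "openin \<G> V" "openin \<G> V'" "(g, t\<^sub>0) \<in> V" "(h, t\<^sub>0) \<in> V'"
    "\<And>x y t. (x, t) \<in> V \<Longrightarrow> (y, t) \<in> V' \<Longrightarrow> (x \<otimes> y, t) \<in> W"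
proof (cases "g \<in> U t\<^sub>0 \<and> h \<in> U t\<^sub>0")
  case True
  then show ?thesis
    using mult_neighbourhoods_in_U[OF W t0 _ _ gh] that by metis
next
  case False
  have "openin (subtopology X (H t\<^sub>0)) {x. (x, t\<^sub>0) \<in> W}"
    using W t0 by (simp add: openin_corestricted_topology)
  then obtain R where R: "openin X R" "{x. (x, t\<^sub>0) \<in> W} = R \<inter> H t\<^sub>0"
    unfolding openin_subtopology by blast
  let ?Q = "{p \<in> topspace (prod_topology X X). (case p of (x, y) \<Rightarrow> x \<otimes> y) \<in> R}"
  have "openin (prod_topology X X) ?Q"
    using continuous_map_mult R(1) by (rule openin_continuous_map_preimage)
  moreover have "(g, h) \<in> ?Q"
    using g h gh R(2) H_carrier[OF t0] by (auto simp: topspace_X)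
  ultimately have "\<exists>A B. openin X A \<and> openin X B \<and> g \<in> A \<and> h \<in> B \<and> A \<times> B \<subseteq> ?Q"
    by (rule openin_prod_topology_alt[THEN iffD1, rule_format])
  then obtain A B where AB: "openin X A" "openin X B" "g \<in> A" "h \<in> B" "A \<times> B \<subseteq> ?Q"
    by blast
  have *: "(x \<otimes> y, t\<^sub>0) \<in> W" if "x \<in> A \<inter> H t\<^sub>0" "y \<in> B \<inter> H t\<^sub>0" for x y
  proof -
    have "x \<otimes> y \<in> R"
      using AB(5) that by auto
    moreover have "x \<otimes> y \<in> H t\<^sub>0"
      using that subgroup.m_closed[OF subgroup_H[OF t0]] by blast
    ultimately show ?thesis
      using R(2) by blast
  qed
  \<comment> \<open>The factor that may lie in \<open>\<U>\<close> gets a neighbourhood spread over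
    all of \<open>T\<close>. This suffices because the other neighbourhood lies over
    \<open>t\<^sub>0\<close>, so that only products in \<open>H t\<^sub>0\<close> occur.\<close>
  have outer: "openin \<G> (family_total T H \<inter> D \<times> topspace T)" if "openin X D" for D
    using that by (intro openin_corestricted_restriction) (simp add: openin_prod_Times_iff)
  show ?thesis
  proof (cases "g \<in> U t\<^sub>0")
    case True
    with False have "h \<notin> U t\<^sub>0" by simp
    show ?thesis
      by (rule that[OF outer[OF AB(1)] openin_fibre_outside_U[OF t0 AB(2)]])
        (use \<open>h \<notin> U t\<^sub>0\<close> AB g h t0 in \<open>auto simp: family_total_def intro: *\<close>)
  next
    case False
    show ?thesis
      by (rule that[OF openin_fibre_outside_U[OF t0 AB(1)] outer[OF AB(2)]])
        (use False AB g h t0 in \<open>auto simp: family_total_def intro: *\<close>)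
  qed
qed

lemma continuous_map_bundle_mult:
  "continuous_map (fibre_product \<B>) \<G> (\<lambda>(x, y). (fst x \<otimes> fst y, snd x))"
  unfolding continuous_map_def
proof (intro conjI allI impI)
  let ?P = "fibre_product \<B>" and ?m = "\<lambda>(x, y). (fst x \<otimes> fst y, snd x)"
  have topP: "topspace ?P = {(x, y). x \<in> family_total T H \<and> y \<in> family_total T H \<and> snd x = snd y}"
    by (auto simp: fibre_product_def topspace_corestricted)
  show "?m \<in> topspace ?P \<rightarrow> topspace \<G>"
    by (auto simp: topP topspace_corestricted family_total_def intro: subgroup.m_closed[OF subgroup_H])
  fix W assume W: "openin \<G> W"
  show "openin ?P {p \<in> topspace ?P. ?m p \<in> W}"
  proof (subst openin_subopen, intro ballI)
    fix p assume p: "p \<in> {p \<in> topspace ?P. ?m p \<in> W}"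
    then obtain g h t where ght: "p = ((g, t), (h, t))" "t \<in> topspace T" "g \<in> H t" "h \<in> H t" "(g \<otimes> h, t) \<in> W"
      by (auto simp: topP family_total_def)
    obtain V V' where V: "openin \<G> V" "openin \<G> V'" "(g, t) \<in> V" "(h, t) \<in> V'"
        "\<And>x y t. (x, t) \<in> V \<Longrightarrow> (y, t) \<in> V' \<Longrightarrow> (x \<otimes> y, t) \<in> W"
      using mult_neighbourhoods[OF W ght(2-5)] by metis
    let ?O = "V \<times> V' \<inter> {(x, y). bproj \<B> x = bproj \<B> y}"
    have "openin (prod_topology \<G> \<G>) (V \<times> V')"
      using V by (simp add: openin_prod_Times_iff)
    then have "openin ?P ?O"
      unfolding fibre_product_def openin_subtopology by auto
    moreover have "?O \<subseteq> {p \<in> topspace ?P. ?m p \<in> W}"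
      using V(5) openin_subset[OF calculation] by fastforce
    ultimately show "\<exists>D. openin ?P D \<and> p \<in> D \<and> D \<subseteq> {p \<in> topspace ?P. ?m p \<in> W}"
      using V(3,4) ght(1) by (intro exI[of _ ?O]) auto
  qed
qed

text \<open>Every \<open>U t\<close> contains the unit, so the section factors through
  \<open>\<U>\<close>. There the topology is induced from \<open>G \<times> T\<close>, and
  continuity can be checked componentwise.\<close>

lemma continuous_map_bundle_unit: "continuous_map T \<G> (\<lambda>t. (\<one>, t))"
proof -
  have "continuous_map T (family_topology X T U) (\<lambda>t. (\<one>, t))"
    unfolding family_topology_def
    by (intro continuous_map_into_subtopology continuous_map_pairedI)
      (auto simp: family_total_def topspace_X intro: subgroup.one_closed[OF subgroup_U])
  from continuous_map_compose[OF this continuous_map_from_U] show ?thesis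
    by (simp add: o_def)
qed

text \<open>Inversion preserves \<open>\<U>\<close> and every fibre and is continuous on each of
  them, which is what the final topology tests.\<close>

lemma continuous_map_bundle_inv: "continuous_map \<G> \<G> (\<lambda>x. (inv (fst x), snd x))"
  unfolding continuous_map_def
proof (intro conjI allI impI)
  show "(\<lambda>x. (inv (fst x), snd x)) \<in> topspace \<G> \<rightarrow> topspace \<G>"
    by (auto simp: topspace_corestricted family_total_def intro: subgroup.m_inv_closed[OF subgroup_H])
  fix W assume W: "openin \<G> W"
  let ?V = "{x \<in> topspace \<G>. (inv (fst x), snd x) \<in> W}"
  let ?\<U> = "family_topology X T U"
  have "continuous_map ?\<U> ?\<U> (\<lambda>x. (inv (fst x), snd x))"
    unfolding family_topology_def
  proof (rule continuous_map_into_subtopology[OF continuous_map_from_subtopology])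
    show "continuous_map (prod_topology X T) (prod_topology X T) (\<lambda>x. (inv (fst x), snd x))"
      using continuous_map_compose[OF continuous_map_fst continuous_map_inv]
      by (intro continuous_map_pairedI continuous_map_snd) (simp add: o_def)
  qed (auto simp: family_total_def intro: subgroup.m_inv_closed[OF subgroup_U])
  moreover have "openin ?\<U> (W \<inter> family_total T U)"
    using W by (simp add: openin_corestricted_topology)
  ultimately have "openin ?\<U> {x \<in> topspace ?\<U>. (inv (fst x), snd x) \<in> W \<inter> family_total T U}"
    by (rule openin_continuous_map_preimage)
  moreover have "{x \<in> topspace ?\<U>. (inv (fst x), snd x) \<in> W \<inter> family_total T U} = ?V \<inter> family_total T U"
    unfolding topspace_U topspace_corestricted
    using U_sub_H by (auto simp: family_total_def intro: subgroup.m_inv_closed[OF subgroup_U])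
  moreover have "openin (subtopology X (H t)) {g. (g, t) \<in> ?V}" if t: "t \<in> topspace T" for t
  proof -
    have "continuous_map (subtopology X (H t)) (subtopology X (H t)) (\<lambda>x. inv x)"
      by (intro continuous_map_into_subtopology continuous_map_from_subtopology continuous_map_inv)
        (auto intro: subgroup.m_inv_closed[OF subgroup_H[OF t]])
    moreover have "openin (subtopology X (H t)) {g. (g, t) \<in> W}"
      using W t by (simp add: openin_corestricted_topology)
    ultimately have "openin (subtopology X (H t)) {x \<in> topspace (subtopology X (H t)). inv x \<in> {g. (g, t) \<in> W}}"
      by (rule openin_continuous_map_preimage)
    moreover have "{x \<in> topspace (subtopology X (H t)). inv x \<in> {g. (g, t) \<in> W}} = {g. (g, t) \<in> ?V}"
      using t H_carrier[OF t] by (auto simp: topspace_corestricted family_total_def topspace_X)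
    ultimately show ?thesis by simp
  qed
  moreover have "?V \<subseteq> family_total T H"
    by (auto simp: topspace_corestricted)
  ultimately show "openin \<G> ?V"
    by (simp add: openin_corestricted_topology)
qed

section \<open>Fibres and the bundle axioms\<close>

lemma fibre_corestricted: "t \<in> topspace T \<Longrightarrow> fibre \<B> t = H t \<times> {t}"
  by (auto simp: fibre_def topspace_corestricted family_total_def)

lemma group_object_over_corestricted: "group_object_over T \<B>"
proof -
  have "continuous_map \<G> T snd"
    using continuous_map_compose[OF continuous_map_into_constant continuous_map_snd] by (simp add: o_def)
  then show ?thesis
    unfolding group_object_over_def
    using continuous_map_bundle_mult continuous_map_bundle_unit continuous_map_bundle_inv
    by (auto simp: fibre_corestricted m_assoc H_carrier)
qed

text \<open>The fibre carries the topology of a subspace of \<open>\<G>\<close>, not that of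
  \<open>H t\<close>. Instead of comparing the two, the proof gets compactness of the fibre from its
  being a continuous image of \<open>H t\<close>; then \<open>fst\<close> injects it continuously
  into \<open>G\<close>.\<close>

lemma pro_group_fibre:
  assumes t: "t \<in> topspace T" shows "pro_group C (fibre_group \<B> t) (fibre_topology \<B> t)"
proof (rule pro_group_continuous_injection[OF C G fibre_topological_group[OF group_object_over_corestricted t]])
  have "compactin (subtopology X (H t)) (H t)"
    using closedin_compact_space[OF pro_group_compact_clopen_separated(1)[OF C G] closedin_H[OF t]]
    by (simp add: compactin_subtopology)
  from image_compactin[OF this continuous_map_fibre_inclusion[OF t]]
  have "compactin \<G> (fibre \<B> t)"
    by (simp add: fibre_corestricted[OF t] image_Pair_const)
  then show "compact_space (fibre_topology \<B> t)"
    by (simp add: fibre_topology_def compact_space_subtopology)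
  have "continuous_map \<G> X fst"
    using continuous_map_compose[OF continuous_map_into_constant continuous_map_fst] by (simp add: o_def)
  then show "continuous_map (fibre_topology \<B> t) X fst"
    by (simp add: fibre_topology_def continuous_map_from_subtopology)
  show "fst \<in> hom (fibre_group \<B> t) G"
    using H_carrier[OF t] by (auto simp: hom_def fibre_group_def fibre_corestricted[OF t])
  show "inj_on fst (carrier (fibre_group \<B> t))"
    by (auto simp: inj_on_def fibre_group_def fibre_corestricted[OF t])
qed

lemma group_bundle_corestricted: "group_bundle C T \<B>"
proof -
  have "clopen_separated (prod_topology X T)"
    using pro_group_compact_clopen_separated(2)[OF C G] profinite_space_compact_clopen_separated(2)[OF T]
    by (rule clopen_separated_prod_topology)
  then have "clopen_separated \<G>"
    by (rule clopen_separated_continuous_injection[OF _ continuous_map_into_constant]) simp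
  then show ?thesis
    unfolding group_bundle_def
    using T clopen_separated_imp_Hausdorff_space clopen_separated_imp_totally_disconnected_space
      group_object_over_corestricted pro_group_fibre by auto
qed

lemma injective_bundle_morphism_into_constant:
  "injective_bundle_morphism T \<B> (constant_bundle G X T) (\<lambda>x. x)"
proof -
  have "fibre (constant_bundle G X T) t = carrier G \<times> {t}" if "t \<in> topspace T" for t
    using that by (auto simp: fibre_def topspace_X)
  then show ?thesis
    unfolding injective_bundle_morphism_def bundle_morphism_def
    using continuous_map_into_constant
    by (auto simp: hom_def fibre_group_def fibre_corestricted dest: H_carrier)
qed

end

text \<open>If \<open>g \<notin> U t\<close>, regularity separates \<open>g\<close> from the closed
  set \<open>U t\<close> by disjoint open sets \<open>A\<close> and \<open>B\<close>. As
  \<open>B\<close> contains the unit, continuity of the family keeps \<open>U s\<close> inside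
  \<open>B\<close> for all \<open>s\<close> in a neighbourhood \<open>?S\<close> of
  \<open>t\<close>, and the box \<open>A \<times> ?S\<close> misses the total space.\<close>

lemma (in pro_group_families) closedin_family_total:
  assumes cont: "continuous_family G X T U"
  shows "closedin (prod_topology X T) (family_total T U)"
proof -
  let ?P = "prod_topology X T"
  have reg: "regular_space X"
    using pro_group_compact_clopen_separated[OF C G]
    by (intro compact_Hausdorff_imp_regular_space clopen_separated_imp_Hausdorff_space)
  have "openin ?P (topspace ?P - family_total T U)"
  proof (subst openin_subopen, intro ballI)
    fix p assume p: "p \<in> topspace ?P - family_total T U"
    then obtain g t where gt: "p = (g, t)" "g \<in> topspace X" "t \<in> topspace T" "g \<notin> U t"
      by (auto simp: family_total_def)
    have "\<exists>A B. openin X A \<and> openin X B \<and> g \<in> A \<and> U t \<subseteq> B \<and> disjnt A B"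
      using gt closedin_U[OF gt(3)] by (intro reg[unfolded regular_space_def, rule_format]) auto
    then obtain A B where AB: "openin X A" "openin X B" "g \<in> A" "U t \<subseteq> B" "disjnt A B"
      by blast
    let ?S = "{s \<in> topspace T. U s \<subseteq> B}"
    have "\<one> \<in> B"
      using AB(4) subgroup.one_closed[OF subgroup_U[OF gt(3)]] by blast
    then have "openin T ?S"
      using cont AB(2) unfolding continuous_family_def by blast
    then have "openin ?P (A \<times> ?S)"
      using AB(1) by (simp add: openin_prod_Times_iff)
    moreover have "A \<times> ?S \<subseteq> topspace ?P - family_total T U"
      using AB(5) openin_subset[OF AB(1)] by (auto simp: family_total_def disjnt_iff)
    ultimately show "\<exists>D. openin ?P D \<and> p \<in> D \<and> D \<subseteq> topspace ?P - family_total T U"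
      using AB gt by (intro exI[of _ "A \<times> ?S"]) auto
  qed
  moreover have "family_total T U \<subseteq> topspace ?P"
    using U_carrier by (auto simp: family_total_def topspace_X)
  ultimately show ?thesis
    by (simp add: closedin_def)
qed

lemma (in pro_group_families) compact_group_bundle_family:
  assumes "continuous_family G X T U"
  shows "compact_group_bundle C T (family_bundle G X T U)"
proof -
  interpret self: pro_group_families C G X T U U
    by unfold_locales (use C G T U in auto)
  have "compact_space X" "compact_space T"
    using pro_group_compact_clopen_separated(1)[OF C G] profinite_space_compact_clopen_separated(1)[OF T] .
  then have "compact_space (prod_topology X T)"
    by (simp add: compact_space_prod_topology)
  then have "compact_space (family_topology X T U)"
    unfolding family_topology_def
    using closedin_family_total[OF assms] by (intro compact_space_subtopology closedin_compact_space)
  moreover have "clopen_separated (family_topology X T U)"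
  proof (rule clopen_separated_continuous_injection[OF clopen_separated_prod_topology])
    show "continuous_map (family_topology X T U) (prod_topology X T) (\<lambda>x. x)"
      using self.continuous_map_into_constant by (simp add: corestricted_topology_self)
  qed (use pro_group_compact_clopen_separated(2)[OF C G] profinite_space_compact_clopen_separated(2)[OF T]
      in auto)
  ultimately have "profinite_space (family_topology X T U)"
    by (rule profinite_spaceI)
  then show ?thesis
    using self.group_bundle_corestricted
    by (simp add: compact_group_bundle_def corestricted_family_bundle_self)
      (simp add: family_bundle_def)
qed

text \<open>\<open>corestricted_topology\<close> tests slices in \<open>H t\<close>, a corestricted
  bundle in the fibre topology, which is itself induced from \<open>\<G>\<close>. The tests agree
  because a set open in the fibre is the trace of some \<open>W\<close> open in \<open>\<G>\<close>,
  and the slice of \<open>W\<close> over \<open>t\<close> is open in \<open>H t\<close> by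
  construction.\<close>

lemma (in pro_group_families) openin_corestricted_iff_final:
  assumes "V \<subseteq> topspace \<G>"
  shows "openin \<G> V \<longleftrightarrow>
    openin (family_topology X T U) {u \<in> topspace (family_topology X T U). u \<in> V} \<and>
    (\<forall>t \<in> topspace T. openin (fibre_topology \<B> t) (V \<inter> fibre \<B> t))" (is "_ \<longleftrightarrow> ?R")
proof
  assume V: "openin \<G> V"
  then show ?R
    using openin_continuous_map_preimage[OF continuous_map_from_U V]
    by (auto simp: fibre_topology_def openin_subtopology)
next
  assume R: ?R
  have "openin (subtopology X (H t)) {g. (g, t) \<in> V}" if t: "t \<in> topspace T" for t
  proof -
    obtain W where W: "openin \<G> W" "V \<inter> fibre \<B> t = W \<inter> fibre \<B> t"
      using R t by (auto simp: fibre_topology_def openin_subtopology)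
    have "{g. (g, t) \<in> V} = {g. (g, t) \<in> W}"
      using assms openin_subset[OF W(1)] W(2)
      by (fastforce simp: fibre_corestricted[OF t] topspace_corestricted family_total_def set_eq_iff)
    then show ?thesis
      using W(1) t by (simp add: openin_corestricted_topology)
  qed
  moreover have "openin (family_topology X T U) (V \<inter> family_total T U)"
    using R by (simp add: topspace_U Int_def conj_commute)
  ultimately show "openin \<G> V"
    using assms by (simp add: openin_corestricted_topology topspace_corestricted)
qed

lemma (in pro_group_families) injective_bundle_morphism_from_U:
  "injective_bundle_morphism T (family_bundle G X T U) \<B> (\<lambda>x. x)"
proof -
  interpret self: pro_group_families C G X T U U
    by unfold_locales (use C G T U in auto)
  show ?thesis
    unfolding injective_bundle_morphism_def bundle_morphism_def corestricted_family_bundle_self[symmetric]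
    using continuous_map_from_U U_sub_H
    by (auto simp: corestricted_topology_self hom_def fibre_group_def fibre_corestricted
        self.fibre_corestricted)
qed

theorem theorem3p3:
  fixes C :: "nat monoid set"
    and G :: "'g monoid" and X :: "'g topology"
    and T :: "'t topology"
    and H U :: "'t \<Rightarrow> 'g set"
  assumes "finite_group_class C"
    and "pro_group C G X"
    and "profinite_space T"
    and "\<And>t. t \<in> topspace T \<Longrightarrow> closed_subgroup G X (H t)"
    and "\<And>t. t \<in> topspace T \<Longrightarrow> closed_subgroup G X (U t)"
    and "\<And>t. t \<in> topspace T \<Longrightarrow> U t \<subseteq> H t"
    and "continuous_family G X T U"
  shows "corestricted_bundle C T (corestricted_family_bundle G X T H U) (family_bundle G X T U)
    \<and> corestricted_bundle_via C T (corestricted_family_bundle G X T H U) (family_bundle G X T U) (\<lambda>x. x)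
    \<and> topspace (total_space (family_bundle G X T U)) = family_total T U
    \<and> topspace (total_space (corestricted_family_bundle G X T H U)) = family_total T H
    \<and> injective_bundle_morphism T (family_bundle G X T U) (corestricted_family_bundle G X T H U) (\<lambda>x. x)
    \<and> injective_bundle_morphism T (corestricted_family_bundle G X T H U) (constant_bundle G X T) (\<lambda>x. x)"
proof -
  interpret pro_group_families C G X T H U
    by unfold_locales (fact assms)+
  have total: "total_space (family_bundle G X T U) = family_topology X T U"
    by (simp add: family_bundle_def)
  have "corestricted_bundle_via C T \<B> (family_bundle G X T U) (\<lambda>x. x)"
    unfolding corestricted_bundle_via_def total
    using group_bundle_corestricted compact_group_bundle_family[OF assms(7)]
      injective_bundle_morphism_from_U openin_corestricted_iff_final
    by simp
  then show ?thesis
    using injective_bundle_morphism_from_U injective_bundle_morphism_into_constant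
      topspace_U topspace_corestricted
    unfolding corestricted_bundle_def total by auto
qed

end
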